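(* Let $\Bbbk$ be an algebraically closed field of characteristic zero, let $n\ge2$, and let $K=K_{1,n,0}=K\{x^{n+1}y\}$. For $a\in\Bbbk^\times$ with $a^n=1$ and $b\in\Bbbk(x)^\times$ let $\eta_{a,b}$ be the Poisson automorphism of $K$ with $x\mapsto ax$, $y\mapsto by$; for $c\in\Bbbk^\times$ with $c^n=-1$ let $\tau_c$ be the Poisson automorphism of $K$ with $x\mapsto cx$, $y\mapsto y^{-1}$. (1) Then $$\mathrm{Aut}_{Poi}(K)=\langle\eta_{a,b},\,\tau_c\mid a,c\in\Bbbk^\times,\;b\in\Bbbk(x)^\times,\;a^n=1,\;c^n=-1\rangle,$$ and there is a short exact sequence $$1\to\Bbbk(x)^\times\rtimes C_n\to\mathrm{Aut}_{Poi}(K)\to C_2\to1,\qquad( * )$$ where we identify $C_n$ with $\{a\in\Bbbk^\times\mid a^n=1\}$ and the action of $C_n$ on $\Bbbk(x)^\times$ is given by the rule $a\cdot b(x)=b(ax)$. (2) If $n$ is odd, then the sequence $( * )$ is right-split and so $$\mathrm{Aut}_{Poi}(K)\cong(\Bbbk(x)^\times\rtimes C_n)\rtimes C_2,$$ where $C_2$ acts on $\Bbbk(x)^\times\rtimes C_n$ via the automorphism $(b,a)\mapsto(b(-x)^{-1},a)$. If $n$ is even, then $( * )$ is not right-split.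
   Context: For $\mathbf f\in\Bbbk(x,y)$, $K\{\mathbf f\}$ denotes the rational function field $\Bbbk(x,y)$ equipped with the unique ($\Bbbk$-bilinear) Poisson bracket such that $\{x,y\}=\mathbf f$; explicitly $\{g,h\}=\left(\frac{\partial g}{\partial x}\frac{\partial h}{\partial y}-\frac{\partial g}{\partial y}\frac{\partial h}{\partial x}\right)\mathbf f$. $\mathrm{Aut}_{Poi}(K)$ is the group (under composition) of $\Bbbk$-algebra automorphisms of $K$ preserving the Poisson bracket. $C_m$ denotes the cyclic group of order $m$. A short exact sequence $1\to N\to G\to Q\to1$ of groups is right-split if $G\to Q$ has a section that is a group homomorphism. *)

theory Defs
  imports "HOL-Computational_Algebra.Polynomial_Factorial" "HOL-Algebra.Elementary_Groups"
begin

section \<open>The field \<open>k(x,y)\<close>\<close>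

text \<open>
  \<open>k(x)\<close> is the fraction field of \<open>k[x]\<close>, and \<open>k(x,y)\<close> is the fraction field of
  \<open>k[x][y]\<close>: the inner polynomial variable is \<open>x\<close> and the outer one is \<open>y\<close>.
\<close>

type_synonym 'k kx = "'k poly fract"
type_synonym 'k kxy = "'k poly poly fract"

definition const_kxy :: "'k::field \<Rightarrow> 'k kxy"
  where "const_kxy c = to_fract [:[:c:]:]"

definition varx :: "'k::field kxy"
  where "varx = to_fract [:[:0, 1:]:]"

definition vary :: "'k::field kxy"
  where "vary = to_fract [:0, 1:]"

text \<open>
  \<open>on_fract F r\<close> is \<open>F p q\<close> for a representation \<open>r = p/q\<close>. It is used only where the value is
  independent of the representation, see the rules \<open>\<dots>_Fract\<close> below.
\<close>

definition on_fract :: "('r \<Rightarrow> 'r \<Rightarrow> 's) \<Rightarrow> 'r::idom fract \<Rightarrow> 's"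
  where "on_fract F r = (case SOME (p, q). q \<noteq> 0 \<and> r = Fract p q of (p, q) \<Rightarrow> F p q)"

lemma on_fract_Fract:
  assumes "\<And>p q p' q'. q \<noteq> 0 \<Longrightarrow> q' \<noteq> 0 \<Longrightarrow> p * q' = p' * q \<Longrightarrow> F p q = F p' q'"
    and "q \<noteq> 0"
  shows "on_fract F (Fract p q) = F p q"
proof -
  define z where "z = (SOME (p', q'). q' \<noteq> 0 \<and> Fract p q = Fract p' q')"
  have "case z of (p', q') \<Rightarrow> q' \<noteq> 0 \<and> Fract p q = Fract p' q'"
    unfolding z_def by (rule someI[of _ "(p, q)"]) (use assms(2) in simp)
  then have "snd z \<noteq> 0" "p * snd z = fst z * q"
    using assms(2) by (auto simp: eq_fract split: prod.splits)
  then have "F p q = F (fst z) (snd z)"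
    using assms by blast
  then show ?thesis
    by (simp add: on_fract_def z_def case_prod_unfold)
qed

definition of_kx :: "'k::field kx \<Rightarrow> 'k kxy"
  where "of_kx = on_fract (\<lambda>p q. Fract [:p:] [:q:])"

lemma of_kx_Fract:
  "q \<noteq> 0 \<Longrightarrow> of_kx (Fract p q) = Fract [:p:] [:q:]"
  unfolding of_kx_def by (rule on_fract_Fract) (auto simp: eq_fract mult.commute)

text \<open>
  \<open>scale_kx a b\<close> is the rational function \<open>b(ax)\<close>. It is only meaningful for \<open>a \<noteq> 0\<close>, since
  the denominator of \<open>b\<close> may vanish at \<open>0\<close>.
\<close>

definition scale_kx :: "'k::field \<Rightarrow> 'k kx \<Rightarrow> 'k kx"
  where "scale_kx a = on_fract (\<lambda>p q. Fract (pcompose p [:0, a:]) (pcompose q [:0, a:]))"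

lemma scale_kx_Fract:
  assumes "a \<noteq> 0" "q \<noteq> 0"
  shows "scale_kx a (Fract p q) = Fract (pcompose p [:0, a:]) (pcompose q [:0, a:])"
  unfolding scale_kx_def
  by (rule on_fract_Fract)
    (use assms in \<open>auto simp: eq_fract pcompose_eq_0_iff simp flip: pcompose_mult\<close>)

text \<open>The partial derivatives, extended from \<open>k[x][y]\<close> by the quotient rule.\<close>

lemma map_poly_pderiv_add:
  "map_poly pderiv (p + q) = map_poly pderiv p + map_poly pderiv (q :: 'k::field poly poly)"
  by (rule poly_eqI) (simp add: coeff_map_poly pderiv_add)

lemma map_poly_pderiv_mult:
  "map_poly pderiv (p * q) = map_poly pderiv p * q + p * map_poly pderiv (q :: 'k::field poly poly)"
proof (rule poly_eqI)
  fix n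
  have *: "pderiv (sum f A) = (\<Sum>i\<in>A. pderiv (f i))" for f :: "nat \<Rightarrow> 'k poly" and A
    by (induction A rule: infinite_finite_induct) (simp_all add: pderiv_add)
  have **: "pderiv (a * b) = pderiv a * b + a * pderiv b" for a b :: "'k poly"
    by (simp add: pderiv_mult)
  show "coeff (map_poly pderiv (p * q)) n =
        coeff (map_poly pderiv p * q + p * map_poly pderiv q) n"
    by (simp add: coeff_map_poly coeff_mult * ** sum.distrib)
qed

lemma quotient_rule_fractrel:
  fixes D :: "'r::idom \<Rightarrow> 'r"
  assumes "\<And>p q. D (p * q) = D p * q + p * D q"
    and q: "q \<noteq> 0" and q': "q' \<noteq> 0" and eq: "p * q' = p' * q"
  shows "(D p * q - p * D q) * (q' * q') = (D p' * q' - p' * D q') * (q * q)"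
proof -
  have "D p * q' + p * D q' = D p' * q + p' * D q"
    using assms(1)[of p q'] assms(1)[of p' q] eq by simp
  then have *: "D p * q' + p * D q' - (D p' * q + p' * D q) = 0"
    by simp
  have "(D p * q - p * D q) * (q' * q') - (D p' * q' - p' * D q') * (q * q) =
      q * q' * (D p * q' + p * D q' - (D p' * q + p' * D q)) - (p * q' - p' * q) * (q' * D q + q * D q')"
    by (simp add: algebra_simps)
  also have "\<dots> = 0"
    unfolding * using eq by simp
  finally show ?thesis by simp
qed

definition pd_x :: "'k::field kxy \<Rightarrow> 'k kxy"
  where "pd_x = on_fract (\<lambda>p q. Fract (map_poly pderiv p * q - p * map_poly pderiv q) (q * q))"

lemma pd_x_Fract:
  assumes "q \<noteq> 0"
  shows "pd_x (Fract p q) = Fract (map_poly pderiv p * q - p * map_poly pderiv q) (q * q)"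
  unfolding pd_x_def
proof (rule on_fract_Fract)
  fix p q p' q' :: "'a poly poly"
  assume "q \<noteq> 0" "q' \<noteq> 0" "p * q' = p' * q"
  then show "Fract (map_poly pderiv p * q - p * map_poly pderiv q) (q * q) =
      Fract (map_poly pderiv p' * q' - p' * map_poly pderiv q') (q' * q')"
    using quotient_rule_fractrel[of "map_poly pderiv", OF map_poly_pderiv_mult] by (simp add: eq_fract)
qed (use assms in auto)

definition pd_y :: "'k::field kxy \<Rightarrow> 'k kxy"
  where "pd_y = on_fract (\<lambda>p q. Fract (pderiv p * q - p * pderiv q) (q * q))"

lemma pd_y_Fract:
  assumes "q \<noteq> 0"
  shows "pd_y (Fract p q) = Fract (pderiv p * q - p * pderiv q) (q * q)"
  unfolding pd_y_def
proof (rule on_fract_Fract)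
  fix p q p' q' :: "'a poly poly"
  assume "q \<noteq> 0" "q' \<noteq> 0" "p * q' = p' * q"
  then have "(pderiv p * q - p * pderiv q) * (q' * q') = (pderiv p' * q' - p' * pderiv q') * (q * q)"
    by (intro quotient_rule_fractrel) (simp_all add: pderiv_mult)
  with \<open>q \<noteq> 0\<close> \<open>q' \<noteq> 0\<close> show "Fract (pderiv p * q - p * pderiv q) (q * q) =
      Fract (pderiv p' * q' - p' * pderiv q') (q' * q')"
    by (simp add: eq_fract)
qed (use assms in auto)

section \<open>Poisson automorphisms\<close>

text \<open>The bracket of \<open>K{f}\<close>, that is, the Poisson bracket on \<open>k(x,y)\<close> with \<open>{x, y} = f\<close>.\<close>

definition pbracket :: "'k::field kxy \<Rightarrow> 'k kxy \<Rightarrow> 'k kxy \<Rightarrow> 'k kxy"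
  where "pbracket f g h = (pd_x g * pd_y h - pd_y g * pd_x h) * f"

definition poisson_automorphism :: "'k::field kxy \<Rightarrow> ('k kxy \<Rightarrow> 'k kxy) \<Rightarrow> bool"
  where "poisson_automorphism f \<phi> \<longleftrightarrow>
    bij \<phi> \<and>
    (\<forall>g h. \<phi> (g + h) = \<phi> g + \<phi> h) \<and>
    (\<forall>g h. \<phi> (g * h) = \<phi> g * \<phi> h) \<and>
    (\<forall>c. \<phi> (const_kxy c) = const_kxy c) \<and>
    (\<forall>g h. \<phi> (pbracket f g h) = pbracket f (\<phi> g) (\<phi> h))"

definition Aut_Poi :: "'k::field kxy \<Rightarrow> ('k kxy \<Rightarrow> 'k kxy) monoid"
  where "Aut_Poi f = \<lparr>carrier = {\<phi>. poisson_automorphism f \<phi>}, monoid.mult = (\<circ>), one = id\<rparr>"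

definition bracket_xy :: "nat \<Rightarrow> 'k::field kxy"
  where "bracket_xy n = varx ^ (n + 1) * vary"

abbreviation Aut_K :: "nat \<Rightarrow> ('k::field kxy \<Rightarrow> 'k kxy) monoid"
  where "Aut_K n \<equiv> Aut_Poi (bracket_xy n)"

definition eta :: "nat \<Rightarrow> 'k::field \<Rightarrow> 'k kx \<Rightarrow> 'k kxy \<Rightarrow> 'k kxy"
  where "eta n a b = (THE \<phi>. poisson_automorphism (bracket_xy n) \<phi> \<and>
    \<phi> varx = const_kxy a * varx \<and> \<phi> vary = of_kx b * vary)"

definition tau :: "nat \<Rightarrow> 'k::field \<Rightarrow> 'k kxy \<Rightarrow> 'k kxy"
  where "tau n c = (THE \<phi>. poisson_automorphism (bracket_xy n) \<phi> \<and>
    \<phi> varx = const_kxy c * varx \<and> \<phi> vary = inverse vary)"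

section \<open>Groups and extensions\<close>

definition kx_units :: "'k::field kx monoid"
  where "kx_units = \<lparr>carrier = {b. b \<noteq> 0}, monoid.mult = (*), one = 1\<rparr>"

definition roots_of_unity :: "nat \<Rightarrow> 'k::field monoid"
  where "roots_of_unity n = \<lparr>carrier = {a. a \<noteq> 0 \<and> a ^ n = 1}, monoid.mult = (*), one = 1\<rparr>"

text \<open>\<open>semidirect N H act\<close> is \<open>N \<rtimes> H\<close>, where \<open>act h\<close> is the automorphism of \<open>N\<close> given by \<open>h\<close>.\<close>

definition semidirect ::
    "('n, 'x) monoid_scheme \<Rightarrow> ('h, 'y) monoid_scheme \<Rightarrow> ('h \<Rightarrow> 'n \<Rightarrow> 'n) \<Rightarrow> ('n \<times> 'h) monoid"
  where "semidirect N H act =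
    \<lparr>carrier = carrier N \<times> carrier H,
     monoid.mult = (\<lambda>(u, h) (u', h'). (u \<otimes>\<^bsub>N\<^esub> act h u', h \<otimes>\<^bsub>H\<^esub> h')),
     one = (\<one>\<^bsub>N\<^esub>, \<one>\<^bsub>H\<^esub>)\<rparr>"

text \<open>
  Exactness of \<open>1 \<rightarrow> N \<rightarrow> G \<rightarrow> Q \<rightarrow> 1\<close> with maps \<open>\<iota>\<close> and \<open>\<pi>\<close>. The notion in
  HOL-Algebra (\<open>short_exact_sequence\<close>) forces all groups to have elements of the same type.
\<close>

definition short_exact ::
    "('n, 'x) monoid_scheme \<Rightarrow> ('g, 'y) monoid_scheme \<Rightarrow> ('q, 'z) monoid_scheme \<Rightarrow>
     ('n \<Rightarrow> 'g) \<Rightarrow> ('g \<Rightarrow> 'q) \<Rightarrow> bool"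
  where "short_exact N G Q \<iota> \<pi> \<longleftrightarrow>
    group N \<and> group G \<and> group Q \<and> \<iota> \<in> mon N G \<and> \<pi> \<in> epi G Q \<and>
    \<iota> ` carrier N = kernel G Q \<pi>"

definition right_split ::
    "('g, 'y) monoid_scheme \<Rightarrow> ('q, 'z) monoid_scheme \<Rightarrow> ('g \<Rightarrow> 'q) \<Rightarrow> bool"
  where "right_split G Q \<pi> \<longleftrightarrow> (\<exists>s \<in> hom Q G. \<forall>q \<in> carrier Q. \<pi> (s q) = q)"

definition kx_units_Cn :: "nat \<Rightarrow> ('k::field kx \<times> 'k) monoid"
  where "kx_units_Cn n = semidirect kx_units (roots_of_unity n) scale_kx"

text \<open>The cyclic group of order \<open>2\<close> is \<open>{0, 1}\<close> with addition modulo \<open>2\<close>.\<close>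

abbreviation C2 :: "int monoid"
  where "C2 \<equiv> integer_mod_group 2"

definition C2_act :: "int \<Rightarrow> 'k::field kx \<times> 'k \<Rightarrow> 'k kx \<times> 'k"
  where "C2_act s = (if s = 0 then id else (\<lambda>(b, a). (inverse (scale_kx (-1) b), a)))"

section \<open>Well-definedness of \<open>eta\<close> and \<open>tau\<close>\<close>

definition subst_kxy :: "'k::field kxy \<Rightarrow> 'k kxy \<Rightarrow> 'k poly poly \<Rightarrow> 'k kxy"
  where "subst_kxy u v p = poly (map_poly (\<lambda>q. poly (map_poly const_kxy q) u) p) v"

lemma const_kxy_simps [simp]:
  "const_kxy 0 = 0" "const_kxy 1 = 1"
  "const_kxy (c + d) = const_kxy c + const_kxy d"
  "const_kxy (c * d) = const_kxy c * const_kxy d"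
  "const_kxy c = 0 \<longleftrightarrow> c = 0"
  by (simp_all add: const_kxy_def one_pCons[symmetric] flip: to_fract_add to_fract_mult)

lemma const_kxy_power: "const_kxy (c ^ m) = const_kxy c ^ m"
  by (induction m) simp_all

lemma poly_map_poly_add:
  fixes h :: "'a::comm_ring_1 \<Rightarrow> 'b::comm_ring_1"
  assumes "h 0 = 0" "\<And>a b. h (a + b) = h a + h b"
  shows "poly (map_poly h (p + q)) v = poly (map_poly h p) v + poly (map_poly h q) v"
proof -
  have "map_poly h (p + q) = map_poly h p + map_poly h q"
    by (rule poly_eqI) (simp add: coeff_map_poly assms)
  then show ?thesis by simp
qed

lemma poly_map_poly_mult:
  fixes h :: "'a::comm_ring_1 \<Rightarrow> 'b::comm_ring_1"
  assumes "h 0 = 0" "\<And>a b. h (a + b) = h a + h b" "\<And>a b. h (a * b) = h a * h b"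
  shows "poly (map_poly h (p * q)) v = poly (map_poly h p) v * poly (map_poly h q) v"
proof (induction p)
  case 0
  then show ?case by simp
next
  case (pCons a p)
  have *: "map_poly h (smult a q) = smult (h a) (map_poly h q)"
    by (rule poly_eqI) (simp add: coeff_map_poly assms)
  show ?case
    by (simp add: poly_map_poly_add[of h, OF assms(1,2)] * map_poly_pCons assms(1) pCons.IH algebra_simps)
qed

lemma subst_kxy_simps [simp]:
  "subst_kxy u v 0 = 0" "subst_kxy u v 1 = 1"
  "subst_kxy u v (p + q) = subst_kxy u v p + subst_kxy u v q"
  "subst_kxy u v (p * q) = subst_kxy u v p * subst_kxy u v q"
  "subst_kxy u v [:[:c:]:] = const_kxy c"
  "subst_kxy u v [:[:0, 1:]:] = u"
  "subst_kxy u v [:0, 1:] = v"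
  by (simp_all add: subst_kxy_def poly_map_poly_add poly_map_poly_mult map_poly_pCons)

definition kxy_hom :: "('k::field kxy \<Rightarrow> 'k kxy) \<Rightarrow> bool"
  where "kxy_hom \<phi> \<longleftrightarrow> (\<forall>g h. \<phi> (g + h) = \<phi> g + \<phi> h) \<and> (\<forall>g h. \<phi> (g * h) = \<phi> g * \<phi> h) \<and>
    (\<forall>c. \<phi> (const_kxy c) = const_kxy c)"

lemma kxy_homD:
  assumes "kxy_hom \<phi>"
  shows "\<phi> (g + h) = \<phi> g + \<phi> h" "\<phi> (g * h) = \<phi> g * \<phi> h" "\<phi> (const_kxy c) = const_kxy c"
    "\<phi> 0 = 0" "\<phi> 1 = 1" "\<phi> (g - h) = \<phi> g - \<phi> h" "\<phi> (- g) = - \<phi> g"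
    "\<phi> g = 0 \<longleftrightarrow> g = 0" "\<phi> (inverse g) = inverse (\<phi> g)" "\<phi> (g / h) = \<phi> g / \<phi> h" "\<phi> (g ^ m) = \<phi> g ^ m"
proof -
  have a: "\<phi> (g + h) = \<phi> g + \<phi> h" and m: "\<phi> (g * h) = \<phi> g * \<phi> h"
    and c: "\<phi> (const_kxy c) = const_kxy c" for g h c
    using assms by (auto simp: kxy_hom_def)
  have 0: "\<phi> 0 = 0" and 1: "\<phi> 1 = 1"
    using c[of 0] c[of 1] by simp_all
  have u: "\<phi> (- g) = - \<phi> g" for g
    using a[of g "- g"] 0 by (simp add: eq_neg_iff_add_eq_0 add.commute)
  have d: "\<phi> (g - h) = \<phi> g - \<phi> h" for g h
    using a[of g "- h"] u[of h] by simp
  have z: "\<phi> g = 0 \<longleftrightarrow> g = 0" for g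
  proof
    assume "\<phi> g = 0"
    show "g = 0"
    proof (rule ccontr)
      assume "g \<noteq> 0"
      then have "\<phi> (g * inverse g) = 1" by (simp add: 1)
      then show False using \<open>\<phi> g = 0\<close> by (simp add: m)
    qed
  qed (simp add: 0)
  have i: "\<phi> (inverse g) = inverse (\<phi> g)" for g
  proof (cases "g = 0")
    case False
    then have "\<phi> g * \<phi> (inverse g) = 1" by (simp add: m[symmetric] 1)
    then show ?thesis by (simp add: inverse_unique)
  qed (simp add: 0)
  have p: "\<phi> (g ^ m) = \<phi> g ^ m"
    by (induction m) (simp_all add: 1 m)
  show "\<phi> (g + h) = \<phi> g + \<phi> h" "\<phi> (g * h) = \<phi> g * \<phi> h" "\<phi> (const_kxy c) = const_kxy c"
    "\<phi> 0 = 0" "\<phi> 1 = 1" "\<phi> (g - h) = \<phi> g - \<phi> h" "\<phi> (- g) = - \<phi> g"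
    "\<phi> g = 0 \<longleftrightarrow> g = 0" "\<phi> (inverse g) = inverse (\<phi> g)" "\<phi> (g / h) = \<phi> g / \<phi> h" "\<phi> (g ^ m) = \<phi> g ^ m"
    by (fact a m c 0 1 d u z i p | simp add: divide_inverse m i)+
qed

lemma subfield_kxy_eq_UNIV:
  assumes c: "\<And>c. const_kxy c \<in> S" and x: "varx \<in> S"
    and a: "\<And>g h. g \<in> S \<Longrightarrow> h \<in> S \<Longrightarrow> g + h \<in> S" and m: "\<And>g h. g \<in> S \<Longrightarrow> h \<in> S \<Longrightarrow> g * h \<in> S"
    and d: "\<And>g h. g \<in> S \<Longrightarrow> h \<in> S \<Longrightarrow> g / h \<in> S"
  shows "of_kx b \<in> S" and "vary \<in> S \<Longrightarrow> g \<in> (S :: 'k::field kxy set)"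
proof -
  have q: "to_fract [:q:] \<in> S" for q :: "'k poly"
  proof (induction q)
    case (pCons c q)
    have "to_fract [:pCons c q:] = const_kxy c + varx * to_fract [:q:]"
      by (simp add: const_kxy_def varx_def flip: to_fract_add to_fract_mult)
    then show ?case using pCons c x a m by simp
  qed (use c[of 0] in simp)
  show "of_kx b \<in> S"
  proof (cases b)
    case (Fract p q)
    then have "of_kx b = Fract [:p:] [:q:]" by (simp add: of_kx_Fract)
    then show ?thesis using d q by (simp add: Fract_conv_to_fract)
  qed
  assume y: "vary \<in> S"
  have p: "to_fract p \<in> S" for p :: "'k poly poly"
  proof (induction p)
    case (pCons c p)
    have "to_fract (pCons c p) = to_fract [:c:] + vary * to_fract p"
      by (simp add: vary_def flip: to_fract_add to_fract_mult)
    then show ?case using pCons q y a m by simp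
  qed (use c[of 0] in simp)
  show "g \<in> S"
    by (cases g) (simp add: Fract_conv_to_fract d p)
qed

lemma kxy_hom_eqI:
  assumes "kxy_hom \<phi>" "kxy_hom \<psi>" "\<phi> varx = \<psi> varx" "\<phi> vary = \<psi> vary"
  shows "\<phi> = \<psi>"
proof
  fix g
  have "g \<in> {g. \<phi> g = \<psi> g}"
    by (rule subfield_kxy_eq_UNIV(2))
      (use assms in \<open>simp_all add: kxy_homD[OF assms(1)] kxy_homD[OF assms(2)]\<close>)
  then show "\<phi> g = \<psi> g" by simp
qed

lemma kxy_hom_bij:
  assumes "kxy_hom \<phi>" "varx \<in> range \<phi>" "(\<And>b. of_kx b \<in> range \<phi>) \<Longrightarrow> vary \<in> range \<phi>"
  shows "bij \<phi>"
proof -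
  note h = kxy_homD[OF assms(1)]
  have *: "const_kxy c \<in> range \<phi>" for c
    using h(3)[of c, symmetric] by (rule range_eqI)
  have **: "g \<in> range \<phi> \<Longrightarrow> h \<in> range \<phi> \<Longrightarrow> g + h \<in> range \<phi>"
    "g \<in> range \<phi> \<Longrightarrow> h \<in> range \<phi> \<Longrightarrow> g * h \<in> range \<phi>"
    "g \<in> range \<phi> \<Longrightarrow> h \<in> range \<phi> \<Longrightarrow> g / h \<in> range \<phi>" for g h
    by (auto simp flip: h)
  have b: "of_kx b \<in> range \<phi>" for b
    by (rule subfield_kxy_eq_UNIV(1)) (fact * assms(2) **)+
  have "g \<in> range \<phi>" for g
    by (rule subfield_kxy_eq_UNIV(2)) (fact * assms(2) ** assms(3)[OF b])+
  then have "surj \<phi>" by auto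
  moreover have "inj \<phi>" by (rule injI) (metis h(6,8) eq_iff_diff_eq_0)
  ultimately show ?thesis by (simp add: bij_def)
qed

lemma quotient_rule_derivation:
  fixes \<Delta> :: "'r::idom fract \<Rightarrow> 'r fract" and D :: "'r \<Rightarrow> 'r"
  assumes \<Delta>: "\<And>p q. q \<noteq> 0 \<Longrightarrow> \<Delta> (Fract p q) = Fract (D p * q - p * D q) (q * q)"
    and add: "\<And>p q. D (p + q) = D p + D q" and mult: "\<And>p q. D (p * q) = D p * q + p * D q"
  shows "\<Delta> (g + h) = \<Delta> g + \<Delta> h" "\<Delta> (g * h) = \<Delta> g * h + g * \<Delta> h"
proof -
  have same_denom: "Fract x z + Fract y z = Fract (x + y) z" if "z \<noteq> 0" for x y z :: 'r
    using that by (simp add: eq_fract algebra_simps)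
  obtain a b c d where g: "g = Fract a b" "b \<noteq> 0" and h: "h = Fract c d" "d \<noteq> 0"
    by (cases g; cases h)
  define z where "z = b * d"
  have z: "z \<noteq> 0" using g h by (simp add: z_def)
  have g': "g = Fract (a * d) z" and h': "h = Fract (c * b) z"
    using g h by (simp_all add: z_def eq_fract)
  have "g + h = Fract (a * d + c * b) z"
    unfolding g' h' using z by (rule same_denom)
  then have "\<Delta> (g + h) = Fract (D (a * d + c * b) * z - (a * d + c * b) * D z) (z * z)"
    using \<Delta>[OF z] by (simp only:)
  also have "D (a * d + c * b) * z - (a * d + c * b) * D z =
      (D (a * d) * z - a * d * D z) + (D (c * b) * z - c * b * D z)"
    unfolding add by (simp only: algebra_simps)
  also have "Fract \<dots> (z * z) =
      Fract (D (a * d) * z - a * d * D z) (z * z) + Fract (D (c * b) * z - c * b * D z) (z * z)"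
    by (rule same_denom[symmetric]) (use z in simp)
  also have "\<dots> = \<Delta> g + \<Delta> h"
    unfolding g' h' \<Delta>[OF z] ..
  finally show "\<Delta> (g + h) = \<Delta> g + \<Delta> h" .
  have "\<Delta> (g * h) = Fract (D (a * c) * z - a * c * D z) (z * z)"
    using \<Delta>[OF z] by (simp add: g h z_def)
  also have "D (a * c) * z - a * c * D z = (D a * b - a * D b) * (c * d) + a * b * (D c * d - c * D d)"
    by (simp add: z_def mult algebra_simps)
  also have "Fract \<dots> (z * z) =
      Fract ((D a * b - a * D b) * (c * d)) (z * z) + Fract (a * b * (D c * d - c * D d)) (z * z)"
    by (rule same_denom[symmetric]) (use z in simp)
  also have "Fract ((D a * b - a * D b) * (c * d)) (z * z) = \<Delta> g * h"
    using g h z \<Delta>[of b a] by (simp add: eq_fract z_def ac_simps)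
  also have "Fract (a * b * (D c * d - c * D d)) (z * z) = g * \<Delta> h"
    using g h z \<Delta>[of d c] by (simp add: eq_fract z_def ac_simps)
  finally show "\<Delta> (g * h) = \<Delta> g * h + g * \<Delta> h" .
qed

lemma kxy_derivation:
  shows pd_x_add: "pd_x (g + h) = pd_x g + pd_x h" and pd_y_add: "pd_y (g + h) = pd_y g + pd_y h"
    and pd_x_mult: "pd_x (g * h) = pd_x g * h + g * pd_x h"
    and pd_y_mult: "pd_y (g * h) = pd_y g * h + g * pd_y h"
proof -
  note x = quotient_rule_derivation[of pd_x, OF pd_x_Fract map_poly_pderiv_add map_poly_pderiv_mult]
  have m: "pderiv (p * q) = pderiv p * q + p * pderiv q" for p q :: "'a poly poly"
    by (simp add: pderiv_mult)
  note y = quotient_rule_derivation[of pd_y, OF pd_y_Fract pderiv_add m]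
  show "pd_x (g + h) = pd_x g + pd_x h" "pd_y (g + h) = pd_y g + pd_y h"
    "pd_x (g * h) = pd_x g * h + g * pd_x h" "pd_y (g * h) = pd_y g * h + g * pd_y h"
    using x y by blast+
qed

lemma pd_to_fract:
  "pd_x (to_fract p) = to_fract (map_poly pderiv p)" "pd_y (to_fract p) = to_fract (pderiv p)"
proof -
  have "map_poly pderiv 1 = (0 :: 'a poly poly)"
    by (simp add: map_poly_1)
  then show "pd_x (to_fract p) = to_fract (map_poly pderiv p)"
    "pd_y (to_fract p) = to_fract (pderiv p)"
    by (simp_all add: to_fract_def pd_x_Fract pd_y_Fract)
qed

lemma pd_basic [simp]:
  "pd_x (const_kxy c) = 0" "pd_y (const_kxy c) = 0" "pd_x varx = (1 :: 'a kxy)" "pd_y varx = (0 :: 'a kxy)"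
  "pd_x vary = (0 :: 'a kxy)" "pd_y vary = (1 :: 'a::field kxy)"
proof -
  have *: "to_fract [:1:] = (1 :: 'a kxy)" "to_fract [:[:1:]:] = (1 :: 'a kxy)"
    by (metis one_pCons to_fract_1)+
  show "pd_x (const_kxy c) = 0" "pd_y (const_kxy c) = 0" "pd_x varx = (1 :: 'a kxy)"
    "pd_y varx = (0 :: 'a kxy)" "pd_x vary = (0 :: 'a kxy)" "pd_y vary = (1 :: 'a kxy)"
    by (simp_all add: const_kxy_def varx_def vary_def pd_to_fract pderiv_pCons map_poly_pCons *)
qed

lemma pd_y_of_kx [simp]: "pd_y (of_kx b) = 0"
proof (cases b)
  case (Fract p q)
  then have "pd_y (of_kx b) = Fract 0 ([:q:] * [:q:])"
    by (simp add: of_kx_Fract pd_y_Fract pderiv_pCons)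
  then show ?thesis by (simp add: Fract_conv_to_fract)
qed

lemma of_kx_eq_0_iff [simp]: "of_kx b = 0 \<longleftrightarrow> b = 0"
  by (cases b) (simp add: of_kx_Fract Zero_fract_def eq_fract)

definition kxy_deriv :: "('k::field kxy \<Rightarrow> 'k kxy) \<Rightarrow> bool"
  where "kxy_deriv D \<longleftrightarrow> (\<forall>g h. D (g + h) = D g + D h) \<and>
    (\<forall>g h. D (g * h) = D g * h + g * D h) \<and> (\<forall>c. D (const_kxy c) = 0)"

lemma kxy_deriv_pd: "kxy_deriv pd_x" "kxy_deriv pd_y"
  by (simp_all add: kxy_deriv_def kxy_derivation)

lemma kxy_deriv_poly_map_poly:
  fixes h :: "'a::idom \<Rightarrow> 'k::field kxy"
  assumes D: "kxy_deriv D" and h: "h 0 = 0" "\<And>a b. h (a + b) = h a + h b"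
  shows "D (poly (map_poly h p) v) =
    poly (map_poly (\<lambda>a. D (h a)) p) v + poly (map_poly h (pderiv p)) v * D v"
proof (induction p)
  case 0
  have "D 0 = 0" using D unfolding kxy_deriv_def by (metis const_kxy_simps(1))
  then show ?case by simp
next
  case (pCons a p)
  have D0: "D 0 = 0" using D unfolding kxy_deriv_def by (metis const_kxy_simps(1))
  have "D (h a + v * poly (map_poly h p) v) =
      D (h a) + (D v * poly (map_poly h p) v + v * D (poly (map_poly h p) v))"
    using D by (simp add: kxy_deriv_def)
  then show ?case
    by (simp add: map_poly_pCons D0 h(1) pderiv_pCons poly_map_poly_add[of h, OF h] pCons.IH algebra_simps)
qed

lemma kxy_deriv_subst:
  assumes D: "kxy_deriv D"
  shows "D (subst_kxy u v p) =
    subst_kxy u v (map_poly pderiv p) * D u + subst_kxy u v (pderiv p) * D v"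
proof -
  define h where "h = (\<lambda>q. poly (map_poly const_kxy q) u)"
  have h: "h 0 = 0" "h (a + b) = h a + h b" for a b
    by (simp_all add: h_def poly_map_poly_add)
  have z: "map_poly (\<lambda>c. 0) q = 0" for q :: "'a poly"
    by (rule poly_eqI) (simp add: coeff_map_poly)
  have Dh: "D (h q) = h (pderiv q) * D u" for q
    unfolding h_def
    by (subst kxy_deriv_poly_map_poly[OF D]) (use D in \<open>simp_all add: kxy_deriv_def z\<close>)
  have "poly (map_poly (\<lambda>q. h (pderiv q) * D u) p) v = poly (map_poly h (map_poly pderiv p)) v * D u"
    by (induction p) (simp_all add: map_poly_pCons h algebra_simps)
  then show ?thesis
    using kxy_deriv_poly_map_poly[OF D, of h p v] by (simp add: h Dh subst_kxy_def h_def[symmetric])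
qed

definition jacobian :: "'k::field kxy \<Rightarrow> 'k kxy \<Rightarrow> 'k kxy"
  where "jacobian g h = pd_x g * pd_y h - pd_y g * pd_x h"

lemma linear_system_0:
  fixes s t :: "'a::field"
  assumes "s * a + t * b = 0" "s * c + t * d = 0" "a * d - c * b \<noteq> 0"
  shows "s = 0" "t = 0"
proof -
  have "s * (a * d - c * b) = (s * a + t * b) * d - (s * c + t * d) * b"
    "t * (a * d - c * b) = (s * c + t * d) * a - (s * a + t * b) * c"
    by (simp_all add: algebra_simps)
  then show "s = 0" "t = 0" using assms by simp_all
qed

lemma subst_kxy_inj:
  fixes u v :: "'k::field_char_0 kxy"
  assumes J: "jacobian u v \<noteq> 0" and "subst_kxy u v p = 0"
  shows "p = 0"
proof -
  have *: "subst_kxy u v (map_poly pderiv p) = 0 \<and> subst_kxy u v (pderiv p) = 0"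
    if "subst_kxy u v p = 0" for p
  proof -
    have "pd_x 0 = (0 :: 'k kxy)" "pd_y 0 = (0 :: 'k kxy)"
      using pd_basic(1,2)[of 0] by simp_all
    then have "subst_kxy u v (map_poly pderiv p) * pd_x u + subst_kxy u v (pderiv p) * pd_x v = 0"
      "subst_kxy u v (map_poly pderiv p) * pd_y u + subst_kxy u v (pderiv p) * pd_y v = 0"
      using kxy_deriv_subst[OF kxy_deriv_pd(1), of u v p] kxy_deriv_subst[OF kxy_deriv_pd(2), of u v p] that
      by simp_all
    from linear_system_0[OF this] J show ?thesis by (simp add: jacobian_def)
  qed
  have 0: "q = 0" if "subst_kxy u v [:q:] = 0" for q
    using that
  proof (induction "degree q" arbitrary: q rule: less_induct)
    case less
    have "subst_kxy u v [:pderiv q:] = 0"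
      using *[OF less.prems] by (simp add: map_poly_pCons)
    then have "degree q \<noteq> 0 \<Longrightarrow> pderiv q = 0"
      using less.hyps[of "pderiv q"] by (simp add: degree_pderiv)
    then have "degree q = 0" by (auto simp: pderiv_eq_0_iff)
    then obtain c where "q = [:c:]" by (auto elim: degree_eq_zeroE)
    then show ?case using less.prems by simp
  qed
  show ?thesis using assms(2)
  proof (induction "degree p" arbitrary: p rule: less_induct)
    case less
    have "degree p \<noteq> 0 \<Longrightarrow> pderiv p = 0"
      using less.hyps[of "pderiv p"] *[OF less.prems] by (simp add: degree_pderiv)
    then have "degree p = 0" by (auto simp: pderiv_eq_0_iff)
    then obtain c where "p = [:c:]" by (auto elim: degree_eq_zeroE)
    then show ?case using less.prems 0 by simp
  qed
qed

lemma kxy_hom_exists: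
  fixes u v :: "'k::field_char_0 kxy"
  assumes J: "jacobian u v \<noteq> 0"
  obtains \<phi> where "kxy_hom \<phi>" "\<phi> varx = u" "\<phi> vary = v"
    "\<And>g h. jacobian (\<phi> g) (\<phi> h) = \<phi> (jacobian g h) * jacobian u v"
proof -
  define E where "E = subst_kxy u v"
  define \<phi> where "\<phi> = on_fract (\<lambda>p q. E p / E q)"
  have E0: "E p = 0 \<longleftrightarrow> p = 0" for p
    using subst_kxy_inj[OF J] by (auto simp: E_def)
  have F: "\<phi> (Fract p q) = E p / E q" if "q \<noteq> 0" for p q
    unfolding \<phi>_def
  proof (rule on_fract_Fract)
    fix p q p' q' :: "'k poly poly"
    assume "q \<noteq> 0" "q' \<noteq> 0" "p * q' = p' * q"
    then have "E p * E q' = E p' * E q" "E q \<noteq> 0" "E q' \<noteq> 0"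
      using E0 by (simp_all add: E_def flip: subst_kxy_simps(4))
    then show "E p / E q = E p' / E q'" by (simp add: frac_eq_eq)
  qed fact
  have T: "\<phi> (to_fract p) = E p" for p
    by (simp add: to_fract_def F) (simp add: E_def)
  have hom: "kxy_hom \<phi>"
    unfolding kxy_hom_def
  proof safe
    fix g h :: "'k kxy" and c
    obtain a b a' b' where g: "g = Fract a b" "b \<noteq> 0" and h: "h = Fract a' b'" "b' \<noteq> 0"
      by (cases g; cases h)
    show "\<phi> (g + h) = \<phi> g + \<phi> h" "\<phi> (g * h) = \<phi> g * \<phi> h"
      using g h E0[of b] E0[of b'] by (simp_all add: F) (simp_all add: E_def field_simps)
    show "\<phi> (const_kxy c) = const_kxy c"
      by (subst const_kxy_def) (simp add: T, simp add: E_def)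
  qed
  note hD = kxy_homD[OF hom]
  have chain: "D (\<phi> g) = \<phi> (pd_x g) * D u + \<phi> (pd_y g) * D v" if D: "kxy_deriv D" for D g
  proof -
    obtain a b where g: "g = to_fract a / to_fract b" "b \<noteq> 0"
      by (cases g) (simp add: Fract_conv_to_fract)
    define A B where "A = to_fract a" and "B = to_fract b"
    have AB: "A = g * B" "B \<noteq> 0" using g by (simp_all add: A_def B_def)
    have DA: "D (\<phi> A) = \<phi> (pd_x A) * D u + \<phi> (pd_y A) * D v"
      and DB: "D (\<phi> B) = \<phi> (pd_x B) * D u + \<phi> (pd_y B) * D v"
      by (simp_all add: A_def B_def T pd_to_fract E_def kxy_deriv_subst[OF D])
    have "D (\<phi> g) * \<phi> B + \<phi> g * D (\<phi> B) = D (\<phi> A)"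
      using D by (simp add: AB hD kxy_deriv_def)
    also have "\<dots> = (\<phi> (pd_x g) * \<phi> B + \<phi> g * \<phi> (pd_x B)) * D u + (\<phi> (pd_y g) * \<phi> B + \<phi> g * \<phi> (pd_y B)) * D v"
      unfolding DA by (simp add: AB kxy_derivation hD)
    finally have "D (\<phi> g) * \<phi> B = (\<phi> (pd_x g) * D u + \<phi> (pd_y g) * D v) * \<phi> B"
      unfolding DB by (simp add: algebra_simps)
    then show ?thesis using AB by (simp add: hD)
  qed
  show thesis
  proof
    show "\<phi> varx = u" "\<phi> vary = v"
      by (simp_all add: varx_def vary_def T) (simp_all add: E_def)
    show "jacobian (\<phi> g) (\<phi> h) = \<phi> (jacobian g h) * jacobian u v" for g h
      by (simp add: jacobian_def chain[OF kxy_deriv_pd(1)] chain[OF kxy_deriv_pd(2)] hD algebra_simps)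
  qed (fact hom)
qed

lemma poisson_automorphism_ex1:
  fixes u v :: "'k::field_char_0 kxy"
  assumes J: "jacobian u v \<noteq> 0"
    and f: "\<And>\<phi>. kxy_hom \<phi> \<Longrightarrow> \<phi> varx = u \<Longrightarrow> \<phi> vary = v \<Longrightarrow> \<phi> f = jacobian u v * f"
    and bij: "\<And>\<phi>. kxy_hom \<phi> \<Longrightarrow> \<phi> varx = u \<Longrightarrow> \<phi> vary = v \<Longrightarrow> bij \<phi>"
  shows "\<exists>!\<phi>. poisson_automorphism f \<phi> \<and> \<phi> varx = u \<and> \<phi> vary = v"
proof -
  obtain \<phi> where \<phi>: "kxy_hom \<phi>" "\<phi> varx = u" "\<phi> vary = v"
    "\<And>g h. jacobian (\<phi> g) (\<phi> h) = \<phi> (jacobian g h) * jacobian u v"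
    using kxy_hom_exists[OF J] by blast
  have "\<phi> (pbracket f g h) = pbracket f (\<phi> g) (\<phi> h)" for g h
    using \<phi>(4)[of g h] f[OF \<phi>(1-3)]
    by (simp add: pbracket_def jacobian_def[symmetric] kxy_homD[OF \<phi>(1)])
  then have "poisson_automorphism f \<phi>"
    using \<phi>(1) bij[OF \<phi>(1-3)] by (simp add: poisson_automorphism_def kxy_hom_def)
  moreover have "\<psi> = \<phi>" if "poisson_automorphism f \<psi>" "\<psi> varx = u" "\<psi> vary = v" for \<psi>
    by (rule kxy_hom_eqI) (use that \<phi> in \<open>auto simp: poisson_automorphism_def kxy_hom_def\<close>)
  ultimately show ?thesis using \<phi>(2,3) by blast
qed

lemma varxy_nonzero [simp]: "varx \<noteq> 0" "vary \<noteq> 0"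
  by (simp_all add: varx_def vary_def)

lemma kxy_hom_bij_scale:
  assumes \<phi>: "kxy_hom \<phi>" and x: "\<phi> varx = const_kxy a * varx" and "a \<noteq> 0"
    and y': "(\<And>b. of_kx b \<in> range \<phi>) \<Longrightarrow> vary \<in> range \<phi>"
  shows "bij \<phi>"
proof (rule kxy_hom_bij[OF \<phi> _ y'])
  have "\<phi> (varx / const_kxy a) = varx"
    using \<open>a \<noteq> 0\<close> by (simp add: kxy_homD[OF \<phi>] x)
  then show "varx \<in> range \<phi>" by (metis rangeI)
qed

theorem eta_ex1:
  fixes a :: "'k::field_char_0"
  assumes "a \<noteq> 0" "a ^ n = 1" "b \<noteq> 0"
  shows "\<exists>!\<phi>. poisson_automorphism (bracket_xy n) \<phi> \<and>
    \<phi> varx = const_kxy a * varx \<and> \<phi> vary = of_kx b * vary"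
proof (rule poisson_automorphism_ex1)
  have J: "jacobian (const_kxy a * varx) (of_kx b * vary) = const_kxy a * of_kx b"
    by (simp add: jacobian_def kxy_derivation)
  then show "jacobian (const_kxy a * varx) (of_kx b * vary) \<noteq> 0"
    using assms by simp
  fix \<phi> :: "'k kxy \<Rightarrow> 'k kxy"
  assume \<phi>: "kxy_hom \<phi>" "\<phi> varx = const_kxy a * varx" "\<phi> vary = of_kx b * vary"
  have "const_kxy a ^ n = 1" using assms by (simp flip: const_kxy_power)
  then show "\<phi> (bracket_xy n) = jacobian (const_kxy a * varx) (of_kx b * vary) * bracket_xy n"
    unfolding J by (simp add: bracket_xy_def kxy_homD[OF \<phi>(1)] \<phi>(2,3) power_mult_distrib)
  show "bij \<phi>"
  proof (rule kxy_hom_bij_scale[OF \<phi>(1,2) assms(1)])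
    assume "\<And>b. of_kx b \<in> range \<phi>"
    then obtain g where "of_kx b = \<phi> g" by blast
    then have "\<phi> (vary / g) = vary"
      using of_kx_eq_0_iff[of b] \<open>b \<noteq> 0\<close> \<phi>(3) by (simp add: kxy_homD[OF \<phi>(1)])
    then show "vary \<in> range \<phi>" by (metis rangeI)
  qed
qed

theorem tau_ex1:
  fixes c :: "'k::field_char_0"
  assumes "c \<noteq> 0" "c ^ n = -1"
  shows "\<exists>!\<phi>. poisson_automorphism (bracket_xy n) \<phi> \<and>
    \<phi> varx = const_kxy c * varx \<and> \<phi> vary = inverse vary"
proof (rule poisson_automorphism_ex1)
  have "0 = pd_x (vary * inverse vary :: 'k kxy)" "0 = pd_y (vary * inverse vary :: 'k kxy)"
    using pd_basic(1,2)[of 1] by simp_all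
  then have "pd_x (inverse vary) = (0 :: 'k kxy)" "inverse vary + vary * pd_y (inverse vary) = (0 :: 'k kxy)"
    unfolding kxy_derivation by simp_all
  then have "pd_x (inverse vary) = (0 :: 'k kxy)" "pd_y (inverse vary) = - (inverse vary ^ 2 :: 'k kxy)"
    by (simp_all add: field_simps power2_eq_square eq_neg_iff_add_eq_0)
  then have J: "jacobian (const_kxy c * varx) (inverse vary) = - const_kxy c * inverse vary ^ 2"
    by (simp add: jacobian_def kxy_derivation)
  then show "jacobian (const_kxy c * varx) (inverse vary) \<noteq> 0"
    using assms by simp
  fix \<phi> :: "'k kxy \<Rightarrow> 'k kxy"
  assume \<phi>: "kxy_hom \<phi>" "\<phi> varx = const_kxy c * varx" "\<phi> vary = inverse vary"
  have "const_kxy (-1) + 1 = (0 :: 'k kxy)"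
    using const_kxy_simps(3)[of "-1" "1 :: 'k"] by (simp del: const_kxy_simps(3))
  then have cn: "const_kxy c ^ n = -1"
    using const_kxy_power[of c n] assms(2) by (simp add: eq_neg_iff_add_eq_0)
  have "\<phi> (bracket_xy n) = const_kxy c ^ n * const_kxy c * (varx ^ (n + 1) * inverse vary)"
    by (simp add: bracket_xy_def kxy_homD[OF \<phi>(1)] \<phi>(2,3) power_mult_distrib)
  also have "\<dots> = - const_kxy c * (inverse vary * inverse vary * vary) * varx ^ (n + 1)"
    unfolding cn by simp
  also have "\<dots> = jacobian (const_kxy c * varx) (inverse vary) * bracket_xy n"
    unfolding J bracket_xy_def power2_eq_square by (simp only: ac_simps mult_minus_left)
  finally show "\<phi> (bracket_xy n) = jacobian (const_kxy c * varx) (inverse vary) * bracket_xy n" .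
  show "bij \<phi>"
  proof (rule kxy_hom_bij_scale[OF \<phi>(1,2) assms(1)])
    have "\<phi> (inverse vary) = vary" by (simp add: kxy_homD[OF \<phi>(1)] \<phi>(3))
    then show "vary \<in> range \<phi>" by (metis rangeI)
  qed
qed

lemmas eta = eta_ex1[THEN theI', folded eta_def]
  and tau = tau_ex1[THEN theI', folded tau_def]

lemma pbracket_varx_vary: "pbracket f varx vary = f"
  by (simp add: pbracket_def)

end

theory Submission
  imports Defs
begin

text \<open>
  A Poisson automorphism sends \<open>(x, y)\<close> to a pair \<open>(u, v)\<close> with \<open>J(u, v) x\<^sup>n\<^sup>+\<^sup>1 y = u\<^sup>n\<^sup>+\<^sup>1 v\<close>, where
  \<open>J\<close> is the Jacobian determinant. If \<open>u\<close> had a pole at a prime \<open>w\<close> of \<open>k(x)[y]\<close>, then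
  \<open>J(u, v)/(uv) = u\<^sup>n/(x\<^sup>n\<^sup>+\<^sup>1y)\<close> would have a pole of order at least \<open>n \<ge> 2\<close> there, whereas the left
  side has at most a simple pole. Hence \<open>u\<close> is a polynomial in \<open>y\<close>, and comparing degrees in \<open>y\<close>
  gives \<open>u = b(x)\<close>. The leading coefficients in \<open>y\<close> then give \<open>m x\<^sup>n\<^sup>+\<^sup>1 b' = b\<^sup>n\<^sup>+\<^sup>1\<close> with an integer
  \<open>m\<close>, which forces \<open>b = \<alpha>x\<close> with \<open>\<alpha>\<^sup>n = m\<close>, and \<open>y v\<^sub>y = m v\<close>. Applied to the inverse automorphism, the
  same argument gives \<open>m = \<plusminus>1\<close>, so \<open>v = c(x) y\<^sup>\<plusminus>\<^sup>1\<close>. In the extension \<open>\<pi>\<close> is the sign of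
  \<open>\<phi>(x)\<^sup>n/x\<^sup>n\<close>. For even \<open>n\<close> an involution \<open>x \<mapsto> \<alpha>x\<close> has \<open>\<alpha> = \<plusminus>1\<close>, hence \<open>\<alpha>\<^sup>n = 1\<close>, so there
  is no section.
\<close>

section \<open>\<open>k(x,y)\<close> as the fraction field of \<open>k(x)[y]\<close>\<close>

text \<open>Makes k(x) a coefficient field of characteristic zero, so that over it a polynomial in y
  with zero derivative is constant.\<close>

instance fract :: ("{idom, ring_char_0}") field_char_0
proof
  show "inj (of_nat :: nat \<Rightarrow> 'a fract)"
    by (rule injI) (simp add: of_nat_fract eq_fract)
qed

section \<open>The embedding of k(x) into k(x,y) and the derivation d/dx\<close>

lemma of_kx_simps [simp]:
  "of_kx 0 = 0" "of_kx 1 = 1" "of_kx (b + c) = of_kx b + of_kx c"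
  "of_kx (b * c) = of_kx b * of_kx c"
proof -
  show "of_kx 0 = 0" by simp
  have "of_kx (to_fract 1) = to_fract 1"
    by (simp only: to_fract_def of_kx_Fract one_neq_zero not_False_eq_True one_pCons[symmetric])
  then show "of_kx 1 = 1" by simp
  show "of_kx (b + c) = of_kx b + of_kx c"
    by (cases b; cases c) (simp add: of_kx_Fract mult.commute)
  show "of_kx (b * c) = of_kx b * of_kx c"
    by (cases b; cases c) (simp add: of_kx_Fract mult.commute)
qed

lemma of_kx_uminus [simp]: "of_kx (- b) = - of_kx b"
  using of_kx_simps(3)[of b "- b"] by (simp add: eq_neg_iff_add_eq_0 add.commute)

lemma of_kx_diff [simp]: "of_kx (b - c) = of_kx b - of_kx c"
  using of_kx_simps(3)[of b "- c"] by simp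

lemma of_kx_eq_iff [simp]: "of_kx b = of_kx c \<longleftrightarrow> b = c"
  using of_kx_eq_0_iff[of "b - c"] by simp

lemma of_kx_inverse [simp]: "of_kx (inverse b) = inverse (of_kx b)"
proof (cases "b = 0")
  case False
  then have "of_kx b * of_kx (inverse b) = 1" by (simp flip: of_kx_simps(4))
  then show ?thesis by (simp add: inverse_unique)
qed simp

lemma of_kx_divide [simp]: "of_kx (b / c) = of_kx b / of_kx c"
  by (simp add: divide_inverse)

lemma of_kx_to_fract: "of_kx (to_fract p) = to_fract [:p:]"
  by (simp add: to_fract_def of_kx_Fract flip: one_pCons)

lemma of_kx_const [simp]: "of_kx (to_fract [:c:]) = const_kxy c"
  by (simp add: of_kx_to_fract const_kxy_def)

lemma of_kx_varx [simp]: "of_kx (to_fract [:0, 1:]) = varx"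
  by (simp add: of_kx_to_fract varx_def)

text \<open>The derivation d/dx of k(x), pulled back along the injective \<open>of_kx\<close>. The
  pullback is legitimate because \<open>pd_x\<close> maps the image of \<open>of_kx\<close> into
  itself, as the quotient rule below shows.\<close>

definition deriv_kx :: "'k::field kx \<Rightarrow> 'k kx"
  where "deriv_kx b = inv_into UNIV of_kx (pd_x (of_kx b))"

lemma inj_of_kx: "inj of_kx"
  by (rule injI) simp

lemma deriv_kx_Fract:
  assumes "q \<noteq> 0"
  shows "deriv_kx (Fract p q) = Fract (pderiv p * q - p * pderiv q) (q * q)"
proof -
  have "pd_x (of_kx (Fract p q)) = of_kx (Fract (pderiv p * q - p * pderiv q) (q * q))"
    using assms by (simp add: of_kx_Fract pd_x_Fract map_poly_pCons mult.commute)
  then show ?thesis by (simp add: deriv_kx_def inj_of_kx)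
qed

lemma of_kx_deriv_kx [simp]: "of_kx (deriv_kx b) = pd_x (of_kx b)"
proof (cases b)
  case (Fract p q)
  then show ?thesis
    by (simp add: deriv_kx_Fract of_kx_Fract pd_x_Fract map_poly_pCons mult.commute)
qed

text \<open>The embedding of k(x)[y]. Unlike k[x][y], this ring has field coefficients, so
  irreducible elements are prime and degrees in y govern divisibility.\<close>

definition kx_poly :: "'k::field kx poly \<Rightarrow> 'k kxy"
  where "kx_poly P = poly (map_poly of_kx P) vary"

lemma kx_poly_simps [simp]:
  "kx_poly 0 = 0" "kx_poly 1 = 1" "kx_poly (P + Q) = kx_poly P + kx_poly Q"
  "kx_poly (P * Q) = kx_poly P * kx_poly Q" "kx_poly [:b:] = of_kx b" "kx_poly [:0, 1:] = vary"
  by (simp_all add: kx_poly_def poly_map_poly_add poly_map_poly_mult map_poly_pCons)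

lemma kx_poly_uminus [simp]: "kx_poly (- P) = - kx_poly P"
  using kx_poly_simps(3)[of P "- P"] by (simp add: eq_neg_iff_add_eq_0 add.commute)

lemma kx_poly_diff [simp]: "kx_poly (P - Q) = kx_poly P - kx_poly Q"
  using kx_poly_simps(3)[of P "- Q"] by simp

lemma kx_poly_power [simp]: "kx_poly (P ^ m) = kx_poly P ^ m"
  by (induction m) simp_all

lemma pd_y_kx_poly: "pd_y (kx_poly P) = kx_poly (pderiv P)"
proof -
  have "map_poly (\<lambda>c. 0) P = (0 :: 'a kxy poly)"
    by (rule poly_eqI) (simp add: coeff_map_poly)
  then show ?thesis
    by (simp add: kx_poly_def kxy_deriv_poly_map_poly[OF kxy_deriv_pd(2), of of_kx])
qed

lemma pd_x_0 [simp]: "pd_x 0 = 0"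
  using pd_basic(1)[of 0] by simp

lemma deriv_kx_0 [simp]: "deriv_kx 0 = 0"
  by (simp flip: of_kx_eq_iff)

lemma pd_x_kx_poly: "pd_x (kx_poly P) = kx_poly (map_poly deriv_kx P)"
proof -
  have "map_poly of_kx (map_poly deriv_kx P) = map_poly (\<lambda>b. pd_x (of_kx b)) P"
    by (rule poly_eqI) (simp add: coeff_map_poly)
  then show ?thesis
    by (simp add: kx_poly_def kxy_deriv_poly_map_poly[OF kxy_deriv_pd(1), of of_kx])
qed

text \<open>Applying \<open>pd_y\<close> to a relation for y over k(x) gives one of lower degree; in
  characteristic zero the descent ends at a constant, where \<open>of_kx\<close> is
  injective.\<close>

lemma kx_poly_eq_0_iff [simp]:
  fixes P :: "'k::field_char_0 kx poly"
  shows "kx_poly P = 0 \<longleftrightarrow> P = 0"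
proof
  assume "kx_poly P = 0"
  then show "P = 0"
  proof (induction "degree P" arbitrary: P rule: less_induct)
    case less
    have "pd_y (0 :: 'k kxy) = 0" using pd_basic(2)[of 0] by simp
    then have "kx_poly (pderiv P) = 0"
      using less.prems pd_y_kx_poly[of P] by simp
    then have "degree P \<noteq> 0 \<Longrightarrow> pderiv P = 0"
      using less.hyps[of "pderiv P"] by (simp add: degree_pderiv)
    then have "degree P = 0" by (auto simp: pderiv_eq_0_iff)
    then obtain b where "P = [:b:]" by (auto elim: degree_eq_zeroE)
    then show ?case using less.prems by simp
  qed
qed simp

lemma kx_poly_eq_iff [simp]:
  fixes P :: "'k::field_char_0 kx poly"
  shows "kx_poly P = kx_poly Q \<longleftrightarrow> P = Q"
  using kx_poly_eq_0_iff[of "P - Q"] by (simp del: kx_poly_eq_0_iff)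

text \<open>The quotients form a subfield containing the constants, x and y, hence
  everything.\<close>

lemma kx_poly_quotient:
  fixes g :: "'k::field_char_0 kxy"
  obtains A B where "g = kx_poly A / kx_poly B" "B \<noteq> 0"
proof -
  define S :: "'k kxy set" where "S = {kx_poly A / kx_poly B | A B. B \<noteq> 0}"
  \<comment> \<open>A zero denominator also yields an element of \<open>S\<close>, because division
    by 0 gives 0. This covers \<open>g / h\<close> with \<open>h = 0\<close>.\<close>
  have S: "kx_poly A / kx_poly B \<in> S" for A B
  proof (cases "B = 0")
    case True
    then have "kx_poly A / kx_poly B = kx_poly 0 / kx_poly 1" by simp
    then show ?thesis unfolding S_def using one_neq_zero by blast
  next
    case False
    then show ?thesis unfolding S_def by blast
  qed
  have S1: "kx_poly A \<in> S" for A
    using S[of A 1] by simp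
  have "g \<in> S"
  proof (rule subfield_kxy_eq_UNIV(2))
    show "const_kxy c \<in> S" for c
      using S1[of "[:to_fract [:c:]:]"] by simp
    show "varx \<in> S" "vary \<in> S"
      using S1[of "[:to_fract [:0, 1:]:]"] S1[of "[:0, 1:]"] by simp_all
    fix g h assume "g \<in> S" "h \<in> S"
    then obtain A B C D where g: "g = kx_poly A / kx_poly B" "B \<noteq> 0"
      and h: "h = kx_poly C / kx_poly D" "D \<noteq> 0"
      unfolding S_def by blast
    have "g + h = kx_poly (A * D + C * B) / kx_poly (B * D)"
      "g * h = kx_poly (A * C) / kx_poly (B * D)" "g / h = kx_poly (A * D) / kx_poly (B * C)"
      using g h by (simp_all add: add_frac_eq)
    then show "g + h \<in> S" "g * h \<in> S" "g / h \<in> S" using S by metis+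
  qed
  then show thesis using that by (auto simp: S_def)
qed

text \<open>A denominator of least degree takes the place of a fraction in lowest terms: whenever a
  factor can be cancelled, minimality is violated.\<close>

lemma kx_poly_quotient_minimal:
  fixes g :: "'k::field_char_0 kxy"
  obtains A B where "g = kx_poly A / kx_poly B" "B \<noteq> 0"
    "\<And>C D. D \<noteq> 0 \<Longrightarrow> g * kx_poly D = kx_poly C \<Longrightarrow> degree B \<le> degree D"
proof -
  define R where "R B \<longleftrightarrow> B \<noteq> 0 \<and> (\<exists>A. g * kx_poly B = kx_poly A)" for B
  obtain A0 B0 where "g = kx_poly A0 / kx_poly B0" "B0 \<noteq> 0"
    by (rule kx_poly_quotient)
  then have "R B0" by (auto simp: R_def)
  then obtain B where B: "R B" "\<And>D. R D \<Longrightarrow> degree B \<le> degree D"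
    using ex_has_least_nat[of R B0 degree] by blast
  then obtain A where "B \<noteq> 0" "g * kx_poly B = kx_poly A" by (auto simp: R_def)
  then show thesis
    using B(2) by (intro that[of A B]) (auto simp: R_def field_simps)
qed

text \<open>Differentiating A = g B with g constant in y gives A' = g B', so B' would be a
  denominator of smaller degree unless it vanishes. Then A and B are both constant in y.\<close>

lemma pd_y_eq_0_imp_of_kx:
  fixes g :: "'k::field_char_0 kxy"
  assumes "pd_y g = 0"
  obtains b where "g = of_kx b"
proof -
  obtain A B where g: "g = kx_poly A / kx_poly B" and B: "B \<noteq> 0"
    and minimal: "\<And>C D. D \<noteq> 0 \<Longrightarrow> g * kx_poly D = kx_poly C \<Longrightarrow> degree B \<le> degree D"
    using kx_poly_quotient_minimal by blast
  have "kx_poly A = g * kx_poly B" using g B by simp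
  from arg_cong[OF this, of pd_y] have *: "g * kx_poly (pderiv B) = kx_poly (pderiv A)"
    using assms by (simp add: pd_y_mult pd_y_kx_poly)
  have "pderiv B = 0"
  proof (rule ccontr)
    assume "pderiv B \<noteq> 0"
    then have "degree B \<le> degree (pderiv B)" using * by (rule minimal)
    then show False using \<open>pderiv B \<noteq> 0\<close> by (simp add: degree_pderiv pderiv_eq_0_iff)
  qed
  with * have "pderiv A = 0" by (metis kx_poly_eq_0_iff mult_zero_right)
  with \<open>pderiv B = 0\<close> have "degree A = 0" "degree B = 0" by (simp_all add: pderiv_eq_0_iff)
  then obtain a b where "A = [:a:]" "B = [:b:]"
    by (auto elim!: degree_eq_zeroE)
  then have "g = of_kx (a / b)" using g by simp
  then show thesis by (rule that)
qed

section \<open>Poles\<close>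

text \<open>A divisor of least positive degree cannot be split further.\<close>

lemma irreducible_factor_exists:
  fixes p :: "'a::field poly"
  assumes "degree p > 0"
  obtains q where "irreducible q" "q dvd p"
proof -
  define R where "R q \<longleftrightarrow> q dvd p \<and> degree q > 0" for q
  have "R p" using assms by (simp add: R_def)
  then obtain q where q: "R q" "\<And>r. R r \<Longrightarrow> degree q \<le> degree r"
    using ex_has_least_nat[of R p degree] by blast
  then have "q \<noteq> 0" by (auto simp: R_def)
  have "irreducible q"
  proof (rule irreducibleI)
    fix a b assume ab: "q = a * b"
    then have nz: "a \<noteq> 0" "b \<noteq> 0" using \<open>q \<noteq> 0\<close> by auto
    have "a dvd p" using q(1) ab by (auto simp: R_def dest: dvd_mult_left)
    then have "degree a = 0 \<or> degree b = 0"
      using q(2)[of a] ab nz by (cases "degree a = 0") (auto simp: R_def degree_mult_eq)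
    then show "a dvd 1 \<or> b dvd 1" using nz by (simp add: is_unit_iff_degree)
  qed (use q \<open>q \<noteq> 0\<close> in \<open>auto simp: R_def is_unit_iff_degree\<close>)
  then show thesis using q(1) that by (auto simp: R_def)
qed

text \<open>The localisation of k(x)[y] at \<open>w\<close>, as a subset of k(x,y): the functions
  without a pole at \<open>w\<close>.\<close>

definition local_at :: "'k::field kx poly \<Rightarrow> 'k kxy set"
  where "local_at w = {kx_poly A / kx_poly B | A B. \<not> w dvd B}"

lemma kx_poly_in_local_at:
  assumes "prime_elem w"
  shows "kx_poly A \<in> local_at w"
proof -
  have "\<not> w dvd 1" using assms by (simp add: prime_elem_def)
  moreover have "kx_poly A = kx_poly A / kx_poly 1" by simp
  ultimately show ?thesis unfolding local_at_def by blast
qed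

lemma local_at_closed:
  fixes w :: "'k::field_char_0 kx poly"
  assumes w: "prime_elem w" and g: "g \<in> local_at w" and h: "h \<in> local_at w"
  shows "g + h \<in> local_at w" "g - h \<in> local_at w" "g * h \<in> local_at w"
proof -
  obtain A B C D where g: "g = kx_poly A / kx_poly B" "\<not> w dvd B"
    and h: "h = kx_poly C / kx_poly D" "\<not> w dvd D"
    using g h unfolding local_at_def by blast
  have "\<not> w dvd B * D" using w g h by (simp add: prime_elem_dvd_mult_iff)
  moreover have "B \<noteq> 0" "D \<noteq> 0" using g h by auto
  then have "g + h = kx_poly (A * D + C * B) / kx_poly (B * D)"
    "g - h = kx_poly (A * D - C * B) / kx_poly (B * D)"
    "g * h = kx_poly (A * C) / kx_poly (B * D)"
    using g h by (simp_all add: add_frac_eq diff_frac_eq)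
  ultimately show "g + h \<in> local_at w" "g - h \<in> local_at w" "g * h \<in> local_at w"
    unfolding local_at_def by blast+
qed

text \<open>The constant \<open>\<kappa>\<close> is the order of \<open>g\<close> at \<open>w\<close>.\<close>

lemma log_derivative_principal_part:
  fixes g :: "'k::field_char_0 kxy"
  assumes w: "prime_elem w" and g: "g \<noteq> 0"
  obtains \<kappa> r s where "\<kappa> \<in> local_at w" "r \<in> local_at w" "s \<in> local_at w"
    "pd_x g = g * (\<kappa> * (pd_x (kx_poly w) / kx_poly w) + r)"
    "pd_y g = g * (\<kappa> * (pd_y (kx_poly w) / kx_poly w) + s)"
proof -
  define X Y W where "X = pd_x (kx_poly w) / kx_poly w" and "Y = pd_y (kx_poly w) / kx_poly w"
    and "W = kx_poly w"
  define P where "P g \<longleftrightarrow> (\<exists>\<kappa> \<in> local_at w. \<exists>r \<in> local_at w. \<exists>s \<in> local_at w.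
    pd_x g = g * (\<kappa> * X + r) \<and> pd_y g = g * (\<kappa> * Y + s))" for g
  have "w \<noteq> 0" using w by auto
  then have W: "W \<noteq> 0" by (simp add: W_def)
  then have dW: "pd_x W = W * X" "pd_y W = W * Y" by (simp_all add: X_def Y_def W_def)
  have deg: "degree w > 0"
    using w \<open>w \<noteq> 0\<close> by (auto simp: prime_elem_def is_unit_iff_degree)
  \<comment> \<open>If \<open>w\<close> does not divide \<open>A\<close>, the logarithmic
    derivatives of \<open>A\<close> lie in \<open>local_at w\<close> and \<kappa> is 0; each factor
    \<open>w\<close> split off raises \<kappa> by one.\<close>
  have poly: "P (kx_poly A)" if "A \<noteq> 0" for A
    using that
  proof (induction "degree A" arbitrary: A rule: less_induct)
    case less
    show ?case
    proof (cases "w dvd A")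
      case False
      define r s where "r = pd_x (kx_poly A) / kx_poly A" and "s = pd_y (kx_poly A) / kx_poly A"
      have "r \<in> local_at w" "s \<in> local_at w"
        using False by (auto simp: local_at_def r_def s_def pd_x_kx_poly pd_y_kx_poly)
      moreover have "0 \<in> local_at w" using kx_poly_in_local_at[OF w, of 0] by simp
      ultimately show ?thesis
        using less.prems unfolding P_def
        by (intro bexI[of _ 0] bexI[of _ r] bexI[of _ s]) (simp_all add: r_def s_def)
    next
      case True
      then obtain B where A: "A = w * B" by blast
      then have "B \<noteq> 0" using less.prems by auto
      then have "P (kx_poly B)"
        using less.hyps[of B] deg A \<open>w \<noteq> 0\<close> by (simp add: degree_mult_eq)
      then obtain \<kappa> r s where B: "\<kappa> \<in> local_at w" "r \<in> local_at w" "s \<in> local_at w"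
        "pd_x (kx_poly B) = kx_poly B * (\<kappa> * X + r)"
        "pd_y (kx_poly B) = kx_poly B * (\<kappa> * Y + s)"
        unfolding P_def by blast
      have "1 \<in> local_at w" using kx_poly_in_local_at[OF w, of 1] by simp
      then have "\<kappa> + 1 \<in> local_at w" using B(1) w local_at_closed by blast
      moreover have "kx_poly A = W * kx_poly B" by (simp add: A W_def)
      then have "pd_x (kx_poly A) = kx_poly A * ((\<kappa> + 1) * X + r)"
        "pd_y (kx_poly A) = kx_poly A * ((\<kappa> + 1) * Y + s)"
        using B(4,5) by (simp_all add: kxy_derivation dW algebra_simps)
      ultimately show ?thesis using B(2,3) unfolding P_def by blast
    qed
  qed
  obtain A B where AB: "g = kx_poly A / kx_poly B" "B \<noteq> 0"
    by (rule kx_poly_quotient)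
  then have "A \<noteq> 0" using g by auto
  define a b where "a = kx_poly A" and "b = kx_poly B"
  have gb: "a = g * b" "b \<noteq> 0" using AB by (simp_all add: a_def b_def)
  have "P a" "P b" using poly \<open>A \<noteq> 0\<close> AB(2) by (simp_all add: a_def b_def)
  then obtain \<kappa> r s \<kappa>' r' s' where loc: "\<kappa> \<in> local_at w" "r \<in> local_at w" "s \<in> local_at w"
    "\<kappa>' \<in> local_at w" "r' \<in> local_at w" "s' \<in> local_at w"
    and d: "pd_x a = a * (\<kappa> * X + r)" "pd_y a = a * (\<kappa> * Y + s)"
      "pd_x b = b * (\<kappa>' * X + r')" "pd_y b = b * (\<kappa>' * Y + s')"
    unfolding P_def by blast
  \<comment> \<open>Logarithmic derivatives of a quotient subtract; stated once for both partial
    derivatives.\<close>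
  have *: "D g = g * ((\<kappa> - \<kappa>') * Z + (r - r'))"
    if "D (g * b) = D g * b + g * D b" "D a = a * (\<kappa> * Z + r)" "D b = b * (\<kappa>' * Z + r')" for D Z r r'
  proof -
    have "D g * b = D (g * b) - g * D b" using that(1) by simp
    also have "\<dots> = g * ((\<kappa> - \<kappa>') * Z + (r - r')) * b"
      using that(2,3) by (simp add: gb(1) algebra_simps)
    finally show ?thesis using gb(2) by simp
  qed
  have "pd_x g = g * ((\<kappa> - \<kappa>') * X + (r - r'))" "pd_y g = g * ((\<kappa> - \<kappa>') * Y + (s - s'))"
    by (rule *; use d kxy_derivation in blast)+
  with loc show thesis
    unfolding X_def Y_def W_def by (intro that[of "\<kappa> - \<kappa>'" "r - r'" "s - s'"] local_at_closed(2)[OF w])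
qed

text \<open>The double pole that the product of two logarithmic derivatives could have cancels.\<close>

lemma jacobian_simple_pole:
  fixes g h :: "'k::field_char_0 kxy"
  assumes w: "prime_elem w" and "g \<noteq> 0" "h \<noteq> 0"
  obtains t where "t \<in> local_at w" "kx_poly w * jacobian g h = g * h * t"
proof -
  define X Y W where "X = pd_x (kx_poly w)" and "Y = pd_y (kx_poly w)" and "W = kx_poly w"
  have "w \<noteq> 0" using w by auto
  then have W: "W \<noteq> 0" by (simp add: W_def)
  have XY: "X \<in> local_at w" "Y \<in> local_at w" "W \<in> local_at w"
    using kx_poly_in_local_at[OF w] by (simp_all add: X_def Y_def W_def pd_x_kx_poly pd_y_kx_poly)
  obtain \<kappa> r s where g: "\<kappa> \<in> local_at w" "r \<in> local_at w" "s \<in> local_at w"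
    "pd_x g = g * (\<kappa> * (X / W) + r)" "pd_y g = g * (\<kappa> * (Y / W) + s)"
    using log_derivative_principal_part[OF w \<open>g \<noteq> 0\<close>] unfolding X_def Y_def W_def by blast
  obtain \<mu> r' s' where h: "\<mu> \<in> local_at w" "r' \<in> local_at w" "s' \<in> local_at w"
    "pd_x h = h * (\<mu> * (X / W) + r')" "pd_y h = h * (\<mu> * (Y / W) + s')"
    using log_derivative_principal_part[OF w \<open>h \<noteq> 0\<close>] unfolding X_def Y_def W_def by blast
  \<comment> \<open>This is \<open>W\<close> times the determinant of the logarithmic derivatives.
    The two terms \<kappa> \<mu> X Y / W cancel, which leaves no denominator.\<close>
  define t where "t = \<kappa> * X * s' + r * \<mu> * Y + W * r * s' - \<kappa> * Y * r' - s * \<mu> * X - W * s * r'"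
  have "t \<in> local_at w"
    unfolding t_def using XY g(1-3) h(1-3) by (intro local_at_closed[OF w])
  moreover have "W * jacobian g h = g * h * t"
  proof -
    define p q where "p = X / W" and "q = Y / W"
    then have "X = W * p" "Y = W * q" using W by simp_all
    then show ?thesis
      unfolding jacobian_def g(4,5) h(4,5) t_def p_def[symmetric] q_def[symmetric]
      by (simp add: algebra_simps)
  qed
  ultimately show thesis using that unfolding W_def by blast
qed

section \<open>The image of \<open>x\<close>\<close>

text \<open>A prime factor \<open>w\<close> of a minimal denominator of u would be a pole of u, and
  multiplying the Jacobian identity by \<open>w\<close> would make w u^n regular at
  \<open>w\<close>, which is impossible for n at least 2.\<close>

lemma symplectic_pair_polynomial:
  fixes u v :: "'k::field_char_0 kxy"
  assumes n: "n \<ge> 2" and v: "v \<noteq> 0"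
    and eq: "jacobian u v * bracket_xy n = u ^ (n + 1) * v"
  obtains P where "u = kx_poly P"
proof (cases "u = 0")
  case True
  then show thesis using that[of 0] by simp
next
  case u: False
  obtain A B where AB: "u = kx_poly A / kx_poly B" and B: "B \<noteq> 0"
    and minimal: "\<And>C D. D \<noteq> 0 \<Longrightarrow> u * kx_poly D = kx_poly C \<Longrightarrow> degree B \<le> degree D"
    using kx_poly_quotient_minimal by blast
  have "degree B = 0"
  proof (rule ccontr)
    assume "degree B \<noteq> 0"
    then obtain w where "irreducible w" and wB: "w dvd B"
      using irreducible_factor_exists[of B] by auto
    then have w: "prime_elem w" by (intro field_poly_irreducible_imp_prime)
    then have w0: "w \<noteq> 0" "degree w \<noteq> 0"
      by (auto simp: prime_elem_def is_unit_iff_degree)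
    define W where "W = kx_poly w"
    obtain t where t: "t \<in> local_at w" "W * jacobian u v = u * v * t"
      using jacobian_simple_pole[OF w u v] unfolding W_def by blast
    have "(u * v) * (W * u ^ n) = W * (jacobian u v * bracket_xy n)"
      unfolding eq by simp
    also have "\<dots> = (u * v) * (t * bracket_xy n)"
      using t(2) by (simp only: mult.assoc[symmetric])
    finally have Wu: "W * u ^ n = t * bracket_xy n"
      using u v by simp
    have "bracket_xy n = kx_poly ([:to_fract [:0, 1:]:] ^ (n + 1) * [:0, 1:])"
      unfolding bracket_xy_def kx_poly_simps(4) kx_poly_power by simp
    then have "t * bracket_xy n \<in> local_at w"
      using local_at_closed(3)[OF w t(1)] kx_poly_in_local_at[OF w] by metis
    then obtain C D where CD: "W * u ^ n = kx_poly C / kx_poly D" "\<not> w dvd D"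
      unfolding local_at_def Wu by blast
    then have "D \<noteq> 0" by auto
    with CD(1) B have "kx_poly (w * A ^ n * D) = kx_poly (C * B ^ n)"
      by (simp add: AB W_def power_divide field_simps)
    \<comment> \<open>As \<open>w\<close> divides \<open>B\<close> and n is at least 2, the right
      side contains w^2. Cancelling one \<open>w\<close> leaves another, which must divide
      \<open>A\<close> since it does not divide \<open>D\<close>.\<close>
    then have *: "w * (A ^ n * D) = C * B ^ n" by (simp only: kx_poly_eq_iff mult.assoc)
    obtain E where E: "B = w * E" using wB by blast
    define m where "m = n - 2"
    have m: "n = Suc (Suc m)" using n by (simp add: m_def)
    have "C * B ^ n = w * (w * (C * w ^ m * E ^ n))"
      unfolding E power_mult_distrib m by (simp only: power_Suc ac_simps)
    with * have "w * (A ^ n * D) = w * (w * (C * w ^ m * E ^ n))" by (rule trans)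
    then have "A ^ n * D = w * (C * w ^ m * E ^ n)" using w0 by simp
    then have "w dvd A ^ n * D" by simp
    then have "w dvd A"
      using w CD(2) prime_elem_dvd_mult_iff prime_elem_dvd_power by blast
    then obtain F where F: "A = w * F" by blast
    \<comment> \<open>Cancelling \<open>w\<close> from \<open>A\<close> and \<open>B\<close> leaves
      the smaller denominator \<open>E\<close>.\<close>
    have "E \<noteq> 0" using B E by auto
    moreover have "u * kx_poly E = kx_poly F"
      using \<open>E \<noteq> 0\<close> w0 by (simp add: AB E F)
    ultimately have "degree B \<le> degree E" by (rule minimal)
    then show False using w0 \<open>E \<noteq> 0\<close> by (simp add: E degree_mult_eq)
  qed
  then obtain b where "B = [:b:]" by (auto elim: degree_eq_zeroE)
  then have "u = kx_poly (A * [:inverse b:])"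
    unfolding AB kx_poly_simps(4) by (simp add: divide_inverse)
  then show thesis by (rule that)
qed

text \<open>\<open>a\<close> and \<open>b\<close> are only upper bounds for the degrees because one
  factor will be y Q', which vanishes when Q is constant.\<close>

lemma coeff_top_mult:
  fixes p q :: "'a::comm_semiring_0 poly"
  assumes "degree p \<le> a" "degree q \<le> b"
  shows "coeff (p * q) (a + b) = coeff p a * coeff q b"
proof (cases "degree p = a \<and> degree q = b")
  case True
  then show ?thesis using coeff_mult_degree_sum[of p q] by auto
next
  case False
  then have "degree p + degree q < a + b" using assms by auto
  then have "coeff (p * q) (a + b) = 0"
    by (intro coeff_eq_0 le_less_trans[OF degree_mult_le])
  moreover have "coeff p a = 0 \<or> coeff q b = 0"
    using False assms by (auto simp: coeff_eq_0)
  ultimately show ?thesis by auto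
qed

lemma quotient_rule_numerator:
  fixes a b :: "'k::field kxy"
  assumes "\<And>g h. D (g * h) = D g * h + g * D h" and "b \<noteq> 0"
  shows "D (a / b) * b ^ 2 = D a * b - a * D b"
proof -
  have "D a = D (a / b * b)" using assms(2) by simp
  also have "\<dots> = D (a / b) * b + a / b * D b" by (rule assms(1))
  finally show ?thesis using assms(2) by (simp add: power2_eq_square field_simps)
qed

text \<open>With v = A/B, clearing denominators gives an identity in k(x)[y]. Its right side has
  degree (n+1) deg P + deg A + deg B, its left side at most deg P + deg A + deg B, so P is constant
  in y. The top coefficients then give the differential equation.\<close>

lemma symplectic_pair_of_kx:
  fixes u v :: "'k::field_char_0 kxy"
  assumes n: "n \<ge> 2" and u: "u \<noteq> 0" and v: "v \<noteq> 0"
    and eq: "jacobian u v * bracket_xy n = u ^ (n + 1) * v"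
  obtains b and m :: int where "u = of_kx b"
    "deriv_kx b * to_fract [:0, 1:] ^ (n + 1) * of_int m = b ^ (n + 1)"
proof -
  obtain P where P: "u = kx_poly P"
    using symplectic_pair_polynomial[OF n v eq] by blast
  obtain A B where AB: "v = kx_poly A / kx_poly B" and B: "B \<noteq> 0"
    by (rule kx_poly_quotient)
  have P0: "P \<noteq> 0" and A: "A \<noteq> 0" using u v P AB by auto
  define \<delta> where "\<delta> = (map_poly deriv_kx :: 'k kx poly \<Rightarrow> 'k kx poly)"
  define x :: "'k kx" where "x = to_fract [:0, 1:]"
  define Ry Rx where "Ry = pderiv A * B - A * pderiv B" and "Rx = \<delta> A * B - A * \<delta> B"
  have pd: "pd_x (kx_poly Q) = kx_poly (\<delta> Q)" "pd_y (kx_poly Q) = kx_poly (pderiv Q)" for Q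
    by (simp_all add: \<delta>_def pd_x_kx_poly pd_y_kx_poly)
  have "pd_x v * kx_poly B ^ 2 = kx_poly Rx" "pd_y v * kx_poly B ^ 2 = kx_poly Ry"
    using B by (simp_all add: AB quotient_rule_numerator kxy_derivation pd Rx_def Ry_def)
  then have J: "jacobian u v * kx_poly B ^ 2 = kx_poly (\<delta> P * Ry - pderiv P * Rx)"
    by (simp add: jacobian_def P pd left_diff_distrib mult.assoc)
  have X: "bracket_xy n = kx_poly ([:x:] ^ (n + 1) * [:0, 1:])"
    unfolding bracket_xy_def kx_poly_simps(4) kx_poly_power by (simp add: x_def)
  have "kx_poly ((\<delta> P * Ry - pderiv P * Rx) * ([:x:] ^ (n + 1) * [:0, 1:])) =
      jacobian u v * bracket_xy n * kx_poly B ^ 2"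
    unfolding kx_poly_simps(4)[of "\<delta> P * Ry - pderiv P * Rx"] J[symmetric] X by (simp only: ac_simps)
  also have "\<dots> = kx_poly (P ^ (n + 1) * (A * B))"
    unfolding eq using B by (simp add: P AB power2_eq_square)
  finally have poly: "(\<delta> P * Ry - pderiv P * Rx) * ([:x:] ^ (n + 1) * [:0, 1:]) = P ^ (n + 1) * (A * B)"
    by (simp only: kx_poly_eq_iff)
  have x_pow: "[:x:] ^ (n + 1) = [:x ^ (n + 1):]" by (simp add: poly_const_pow)
  have "degree P = 0"
  proof (rule ccontr)
    assume "degree P \<noteq> 0"
    define d where "d = degree P + degree A + degree B"
    have 1: "degree (\<delta> Q) \<le> degree Q" for Q unfolding \<delta>_def
      by (rule degree_le) (simp add: coeff_map_poly coeff_eq_0)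
    have 2: "degree (pCons 0 (pderiv Q)) \<le> degree Q" for Q :: "'k kx poly"
      by (cases "pderiv Q = 0") (auto simp: degree_pderiv pderiv_eq_0_iff)
    have le: "degree (F * (G * H)) \<le> d" if "degree F + degree G + degree H \<le> d" for F G H :: "'k kx poly"
      using that degree_mult_le[of F "G * H"] degree_mult_le[of G H] by linarith
    \<comment> \<open>Each term has exactly one derivative by y, which absorbs the factor y, and y
      d/dy does not raise the degree.\<close>
    have "(\<delta> P * Ry - pderiv P * Rx) * [:0, 1:] =
      \<delta> P * (pCons 0 (pderiv A) * B) - \<delta> P * (A * pCons 0 (pderiv B)) -
      (pCons 0 (pderiv P) * (\<delta> A * B) - pCons 0 (pderiv P) * (A * \<delta> B))"
      by (simp add: Rx_def Ry_def algebra_simps)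
    also have "degree \<dots> \<le> d"
      by (intro degree_diff_le le)
        (use 1[of P] 1[of A] 1[of B] 2[of P] 2[of A] 2[of B] in \<open>simp_all add: d_def\<close>)
    finally have "degree ((\<delta> P * Ry - pderiv P * Rx) * [:0, 1:]) \<le> d" .
    moreover have "P ^ (n + 1) * (A * B) = smult (x ^ (n + 1)) ((\<delta> P * Ry - pderiv P * Rx) * [:0, 1:])"
      unfolding poly[symmetric] x_pow by simp
    ultimately have "degree (P ^ (n + 1) * (A * B)) \<le> d"
      by (metis (no_types) degree_smult_le le_trans)
    moreover have "degree (P ^ (n + 1) * (A * B)) = (n + 1) * degree P + degree A + degree B"
      using P0 A B by (simp add: degree_mult_eq degree_power_eq)
    ultimately have "n * degree P = 0" by (simp add: d_def)
    then show False using n \<open>degree P \<noteq> 0\<close> by simp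
  qed
  then obtain b where b: "P = [:b:]" by (auto elim: degree_eq_zeroE)
  \<comment> \<open>The degree of v in y, which is the factor produced by y d/dy on leading
    terms.\<close>
  define m where "m = int (degree A) - int (degree B)"
  have top: "coeff (pCons 0 (pderiv Q)) (degree Q) = of_nat (degree Q) * lead_coeff Q"
    "degree (pCons 0 (pderiv Q)) \<le> degree Q" for Q :: "'k kx poly"
    by (cases "degree Q", simp_all add: coeff_pderiv,
        cases "pderiv Q = 0", auto simp: degree_pderiv pderiv_eq_0_iff)
  have "smult (deriv_kx b * x ^ (n + 1)) (pCons 0 (pderiv A) * B - A * pCons 0 (pderiv B)) =
      smult (b ^ (n + 1)) (A * B)"
    using poly unfolding b x_pow poly_const_pow by (simp add: \<delta>_def map_poly_pCons Ry_def mult.commute)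
  then have "coeff (smult (deriv_kx b * x ^ (n + 1)) (pCons 0 (pderiv A) * B - A * pCons 0 (pderiv B)))
      (degree A + degree B) = coeff (smult (b ^ (n + 1)) (A * B)) (degree A + degree B)"
    by simp
  then have "deriv_kx b * x ^ (n + 1) * of_int m * (lead_coeff A * lead_coeff B) =
      b ^ (n + 1) * (lead_coeff A * lead_coeff B)"
    unfolding coeff_smult coeff_diff
    by (simp only: coeff_top_mult top order_refl) (simp add: m_def algebra_simps)
  then have "deriv_kx b * x ^ (n + 1) * of_int m = b ^ (n + 1)"
    using A B by simp
  moreover have "u = of_kx b" by (simp add: P b)
  ultimately show thesis using that by (simp add: x_def)
qed

text \<open>A common root would let a linear factor be cancelled from a denominator of least degree.
  Over an algebraically closed field, having no common root is coprimality.\<close>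

lemma fract_common_root_free:
  fixes b :: "'k::field kx"
  obtains p q where "b = Fract p q" "q \<noteq> 0" "\<And>z. poly p z = 0 \<Longrightarrow> poly q z = 0 \<Longrightarrow> False"
proof -
  define R where "R q \<longleftrightarrow> q \<noteq> 0 \<and> (\<exists>p. b = Fract p q)" for q
  obtain p0 q0 where "b = Fract p0 q0" "q0 \<noteq> 0" by (cases b)
  then have "R q0" by (auto simp: R_def)
  then obtain q where q: "R q" "\<And>r. R r \<Longrightarrow> degree q \<le> degree r"
    using ex_has_least_nat[of R q0 degree] by blast
  then obtain p where p: "b = Fract p q" "q \<noteq> 0" by (auto simp: R_def)
  have False if "poly p z = 0" "poly q z = 0" for z
  proof -
    have "[:-z, 1:] dvd p" "[:-z, 1:] dvd q"
      using that by (simp_all add: poly_eq_0_iff_dvd)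
    then obtain p' q' where pq: "p = [:-z, 1:] * p'" "q = [:-z, 1:] * q'"
      by (elim dvdE)
    then have "q' \<noteq> 0" using p(2) by auto
    moreover have "b = Fract p' q'"
      using p \<open>q' \<noteq> 0\<close> unfolding pq by (simp add: eq_fract algebra_simps)
    ultimately have "degree q \<le> degree q'" by (intro q(2)) (auto simp: R_def)
    moreover have "degree q = degree q' + 1"
      unfolding pq using \<open>q' \<noteq> 0\<close> by (subst degree_mult_eq) auto
    ultimately show False by simp
  qed
  with p show thesis by (rule that)
qed

text \<open>A root of the denominator would also be a root of the numerator, so b is a polynomial r.
  Then deg r - 1 + n + 1 = (n+1) deg r forces degree 1.\<close>

lemma deriv_kx_eq_power:
  fixes b :: "'k::{alg_closed_field, field_char_0} kx"
  assumes n: "n \<ge> 2" and b: "b \<noteq> 0"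
    and eq: "deriv_kx b * to_fract [:0, 1:] ^ (n + 1) * of_int m = b ^ (n + 1)"
  obtains \<alpha> where "\<alpha> \<noteq> 0" "b = to_fract [:0, \<alpha>:]" "\<alpha> ^ n = of_int m"
proof -
  obtain p q where pq: "b = Fract p q" "q \<noteq> 0"
    and no_root: "\<And>z. poly p z = 0 \<Longrightarrow> poly q z = 0 \<Longrightarrow> False"
    using fract_common_root_free[of b] by blast
  define X :: "'k poly" where "X = [:0, 1:]"
  have to_fract_pow: "to_fract r ^ i = to_fract (r ^ i)" for r :: "'k poly" and i
    by (induction i) simp_all
  have "(of_nat i :: 'k kx) = to_fract (of_nat i)" for i
    by (simp add: to_fract_def of_nat_fract)
  then have of_int_to_fract: "(of_int m :: 'k kx) = to_fract (of_int m)"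
    by (cases m) simp_all
  define k where "k = n - 2"
  have k: "n = Suc (Suc k)" using n by (simp add: k_def)
  have "(pderiv p * q - p * pderiv q) * X ^ (n + 1) * of_int m * q ^ (n + 1) = p ^ (n + 1) * (q * q)"
  proof -
    have "to_fract ((pderiv p * q - p * pderiv q) * X ^ (n + 1) * of_int m) / to_fract (q * q) =
        to_fract (p ^ (n + 1)) / to_fract (q ^ (n + 1))"
      using eq[unfolded pq(1) deriv_kx_Fract[OF pq(2)]]
      unfolding Fract_conv_to_fract power_divide to_fract_pow of_int_to_fract X_def[symmetric]
      by (simp only: to_fract_mult times_divide_eq_left)
    then have "to_fract ((pderiv p * q - p * pderiv q) * X ^ (n + 1) * of_int m) * to_fract (q ^ (n + 1)) =
        to_fract (p ^ (n + 1)) * to_fract (q * q)"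
      using pq(2) by (subst (asm) frac_eq_eq) (simp_all del: to_fract_mult)
    then show ?thesis by (simp only: to_fract_mult[symmetric] to_fract_eq_iff)
  qed
  \<comment> \<open>The quotient rule contributes only q^2, so of q^(n+1) the power
    \<open>k + 1\<close> = n - 1 remains. It is positive, hence roots of \<open>q\<close> become
    roots of \<open>p\<close>.\<close>
  then have "q * q * ((pderiv p * q - p * pderiv q) * X ^ (n + 1) * of_int m * q ^ (k + 1)) = q * q * p ^ (n + 1)"
    by (simp add: k ac_simps)
  then have poly: "(pderiv p * q - p * pderiv q) * X ^ (n + 1) * of_int m * q ^ (k + 1) = p ^ (n + 1)"
    using pq(2) by simp
  have "degree q = 0"
  proof (rule ccontr)
    assume "degree q \<noteq> 0"
    then obtain z where z: "poly q z = 0" using alg_closed_imp_poly_has_root[of q] by auto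
    then have "poly (p ^ (n + 1)) z = 0" unfolding poly[symmetric] by simp
    then show False using no_root[of z] z by auto
  qed
  then obtain c where c: "q = [:c:]" by (auto elim: degree_eq_zeroE)
  then have "c \<noteq> 0" using pq by auto
  define r where "r = smult (inverse c) p"
  have r: "b = to_fract r" "p = smult c r"
    using \<open>c \<noteq> 0\<close> pq by (auto simp: to_fract_def r_def c eq_fract mult.commute)
  then have r0: "r \<noteq> 0" using b by auto
  have "smult (c ^ (n + 1)) (pderiv r * X ^ (n + 1) * of_int m) = smult (c ^ (n + 1)) (r ^ (n + 1))"
  proof -
    have "pderiv p * q - p * pderiv q = smult (c * c) (pderiv r)"
      by (simp add: r(2) c pderiv_smult pderiv_pCons)
    moreover have "q ^ (k + 1) = [:c ^ (k + 1):]" by (simp add: c poly_const_pow)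
    moreover have "c ^ (n + 1) = c * c * c ^ (k + 1)" by (simp add: k)
    moreover have "p ^ (n + 1) = smult (c ^ (n + 1)) (r ^ (n + 1))" unfolding r(2) by (rule smult_power)
    ultimately show ?thesis using poly by (simp add: ac_simps del: power_Suc)
  qed
  then have poly: "pderiv r * X ^ (n + 1) * of_int m = r ^ (n + 1)"
    by (rule smult_cancel[rotated]) (use \<open>c \<noteq> 0\<close> in simp)
  have "pderiv r \<noteq> 0" and m: "(of_int m :: 'k poly) \<noteq> 0"
    using poly r0 by (auto simp del: power_Suc)
  then have "degree r > 0" "degree (pderiv r) + 1 = degree r"
    by (auto simp: pderiv_eq_0_iff degree_pderiv)
  moreover have "degree (of_int m :: 'k poly) = 0" by simp
  then have "degree (pderiv r * X ^ (n + 1) * of_int m) = degree (pderiv r) + (n + 1)"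
    using \<open>pderiv r \<noteq> 0\<close> m by (simp add: degree_mult_eq degree_power_eq X_def del: power_Suc)
  then have "degree (pderiv r) + (n + 1) = (n + 1) * degree r"
    unfolding poly by (simp add: r0 degree_power_eq del: power_Suc)
  moreover have "(n + 1) * degree r = n * degree r + degree r" by simp
  ultimately have "n * degree r = n" by linarith
  then have "degree r = 1" using n by simp
  then obtain \<alpha> \<beta> where \<alpha>: "r = [:\<beta>, \<alpha>:]" "\<alpha> \<noteq> 0"
    using degree1_coeffs by metis
  \<comment> \<open>At 0 the factor \<open>X\<close> kills the left side, so \<beta> = 0; at 1 the
    equation reads \<alpha> m = \<alpha>^(n+1).\<close>
  have "poly (pderiv r * X ^ (n + 1) * of_int m) z = poly (r ^ (n + 1)) z" for z
    unfolding poly ..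
  from this[of 0] this[of 1] have "\<beta> = 0" "\<alpha> * of_int m = (\<beta> + \<alpha>) ^ (n + 1)"
    by (auto simp: \<alpha> X_def pderiv_pCons poly_power algebra_simps)
  with \<alpha> r(1) show thesis by (intro that[of \<alpha>]) simp_all
qed

section \<open>Classification of the Poisson automorphisms\<close>

lemma poisson_automorphism_kxy_hom: "poisson_automorphism f \<phi> \<Longrightarrow> kxy_hom \<phi>"
  by (simp add: poisson_automorphism_def kxy_hom_def)

lemma poisson_automorphism_comp:
  "poisson_automorphism f \<phi> \<Longrightarrow> poisson_automorphism f \<psi> \<Longrightarrow> poisson_automorphism f (\<phi> \<circ> \<psi>)"
  by (auto simp: poisson_automorphism_def intro: bij_comp)

lemma poisson_automorphism_id: "poisson_automorphism f id"
  by (simp add: poisson_automorphism_def)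

lemma poisson_automorphism_inv:
  assumes "poisson_automorphism f \<phi>"
  shows "poisson_automorphism f (inv_into UNIV \<phi>)"
proof -
  define \<psi> where "\<psi> = inv_into UNIV \<phi>"
  have \<phi>: "bij \<phi>" "\<phi> (g + h) = \<phi> g + \<phi> h" "\<phi> (g * h) = \<phi> g * \<phi> h" "\<phi> (const_kxy c) = const_kxy c"
    "\<phi> (pbracket f g h) = pbracket f (\<phi> g) (\<phi> h)" for g h c
    using assms by (simp_all add: poisson_automorphism_def)
  have 1: "\<phi> (\<psi> g) = g" for g
    unfolding \<psi>_def using \<phi>(1) by (simp add: bij_is_surj surj_f_inv_f)
  have 2: "\<psi> (\<phi> g) = g" for g
    unfolding \<psi>_def using \<phi>(1) by (simp add: bij_is_inj)
  \<comment> \<open>A transfer rule for arbitrary binary operations, which handles sum, product and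
    bracket alike.\<close>
  have "\<psi> (F (\<phi> (\<psi> g)) (\<phi> (\<psi> h))) = H (\<psi> g) (\<psi> h)"
    if "\<And>g h. \<phi> (H g h) = F (\<phi> g) (\<phi> h)" for F H g h
    using that 2 by metis
  then have hom: "\<psi> (F g h) = H (\<psi> g) (\<psi> h)" if "\<And>g h. \<phi> (H g h) = F (\<phi> g) (\<phi> h)" for F H g h
    using that unfolding 1 by blast
  have "bij \<psi>" unfolding \<psi>_def using \<phi>(1) by (rule bij_imp_bij_inv)
  moreover have "\<psi> (g + h) = \<psi> g + \<psi> h" "\<psi> (g * h) = \<psi> g * \<psi> h"
    "\<psi> (pbracket f g h) = pbracket f (\<psi> g) (\<psi> h)" "\<psi> (const_kxy c) = const_kxy c" for g h c
    using hom[of "(+)" "(+)"] hom[of "(*)" "(*)"] hom[of "pbracket f" "pbracket f"] \<phi> 2[of "const_kxy c"] by simp_all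
  ultimately show ?thesis unfolding poisson_automorphism_def \<psi>_def[symmetric] by blast
qed

text \<open>Preservation of {x, y} is the Jacobian identity treated above. Substituting u = \<alpha>
  x back into it leaves the Euler equation for v, which makes v homogeneous of degree m in
  y.\<close>

lemma poisson_automorphism_varx:
  fixes \<phi> :: "'k::{alg_closed_field, field_char_0} kxy \<Rightarrow> 'k kxy"
  assumes n: "n \<ge> 2" and \<phi>: "poisson_automorphism (bracket_xy n) \<phi>"
  obtains \<alpha> and m :: int where "\<alpha> \<noteq> 0" "\<alpha> ^ n = of_int m" "\<phi> varx = const_kxy \<alpha> * varx"
    "vary * pd_y (\<phi> vary) = const_kxy (of_int m) * \<phi> vary"
proof -
  note hom = kxy_homD[OF poisson_automorphism_kxy_hom[OF \<phi>]]
  define u v where "u = \<phi> varx" and "v = \<phi> vary"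
  have uv: "u \<noteq> 0" "v \<noteq> 0" by (simp_all add: u_def v_def hom)
  have "\<phi> (bracket_xy n) = pbracket (bracket_xy n) u v"
    using \<phi> pbracket_varx_vary[of "bracket_xy n :: 'k kxy"]
    unfolding poisson_automorphism_def u_def v_def by metis
  then have eq: "jacobian u v * bracket_xy n = u ^ (n + 1) * v"
    by (simp add: pbracket_def jacobian_def bracket_xy_def[of n] hom u_def v_def)
  obtain b m where b: "u = of_kx b" "deriv_kx b * to_fract [:0, 1:] ^ (n + 1) * of_int m = b ^ (n + 1)"
    using symplectic_pair_of_kx[OF n uv eq] by blast
  then have "b \<noteq> 0" using uv by auto
  obtain \<alpha> where \<alpha>: "\<alpha> \<noteq> 0" "b = to_fract [:0, \<alpha>:]" "\<alpha> ^ n = of_int m"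
    using deriv_kx_eq_power[OF n \<open>b \<noteq> 0\<close> b(2)] by blast
  have "b = to_fract ([:\<alpha>:] * [:0, 1:])" unfolding \<alpha> by simp
  then have u: "u = const_kxy \<alpha> * varx" unfolding b(1) to_fract_mult by simp
  have "jacobian u v = const_kxy \<alpha> * pd_y v" by (simp add: u jacobian_def kxy_derivation)
  then have "const_kxy \<alpha> * varx ^ (n + 1) * (vary * pd_y v) = const_kxy \<alpha> * varx ^ (n + 1) * (const_kxy (\<alpha> ^ n) * v)"
    using eq by (simp add: bracket_xy_def u power_mult_distrib const_kxy_power ac_simps)
  then have "vary * pd_y v = const_kxy (of_int m) * v"
    using \<alpha>(1) by (simp add: \<alpha>(3) del: power_Suc)
  with \<alpha> u show thesis by (intro that[of \<alpha> m]) (simp_all add: u_def v_def)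
qed

text \<open>The inverse automorphism also scales x, by some \<beta> whose n-th power is an integer
  l. From \<beta> \<alpha> = 1 follows l m = 1, so m is 1 or -1, and the Euler equation says that
  \<open>pd_y\<close> kills v / y or v y respectively.\<close>

lemma poisson_automorphism_cases:
  fixes \<phi> :: "'k::{alg_closed_field, field_char_0} kxy \<Rightarrow> 'k kxy"
  assumes n: "n \<ge> 2" and \<phi>: "poisson_automorphism (bracket_xy n) \<phi>"
  obtains (eta) \<alpha> b where "\<alpha> \<noteq> 0" "\<alpha> ^ n = 1" "b \<noteq> 0" "\<phi> varx = const_kxy \<alpha> * varx" "\<phi> vary = of_kx b * vary"
  | (tau) \<alpha> b where "\<alpha> \<noteq> 0" "\<alpha> ^ n = -1" "b \<noteq> 0" "\<phi> varx = const_kxy \<alpha> * varx"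
      "\<phi> vary = of_kx b * inverse vary"
proof -
  obtain \<alpha> and m :: int where \<alpha>: "\<alpha> \<noteq> 0" "\<alpha> ^ n = of_int m" "\<phi> varx = const_kxy \<alpha> * varx"
    "vary * pd_y (\<phi> vary) = const_kxy (of_int m) * \<phi> vary"
    using poisson_automorphism_varx[OF n \<phi>] by blast
  define \<psi> where "\<psi> = inv_into UNIV \<phi>"
  have \<psi>: "poisson_automorphism (bracket_xy n) \<psi>"
    unfolding \<psi>_def using \<phi> by (rule poisson_automorphism_inv)
  obtain \<beta> and l :: int where \<beta>: "\<beta> ^ n = of_int l" "\<psi> varx = const_kxy \<beta> * varx"
    using poisson_automorphism_varx[OF n \<psi>] by blast
  note hom = kxy_homD[OF poisson_automorphism_kxy_hom[OF \<phi>]]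
  have "\<phi> (\<psi> varx) = varx"
    using \<phi> by (simp add: \<psi>_def poisson_automorphism_def bij_is_surj surj_f_inv_f)
  then have "const_kxy (\<beta> * \<alpha>) * varx = const_kxy 1 * varx"
    by (simp add: \<beta>(2) hom \<alpha>(3) mult.assoc)
  then have "const_kxy (\<beta> * \<alpha>) = const_kxy 1" by (simp del: const_kxy_simps)
  then have "\<beta> * \<alpha> = 1" by (simp add: const_kxy_def del: const_kxy_simps)
  then have "\<beta> ^ n * \<alpha> ^ n = 1" by (simp flip: power_mult_distrib)
  then have "(of_int (l * m) :: 'k) = of_int 1" by (simp add: \<alpha>(2) \<beta>(1))
  then have "l * m = 1" by (simp only: of_int_eq_iff)
  then have m: "m = 1 \<or> m = -1" using zmult_eq_1_iff by blast
  have v: "\<phi> vary \<noteq> 0" by (simp add: hom)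
  show thesis
    using m
  proof
    assume [simp]: "m = 1"
    have "pd_y (\<phi> vary / vary) * vary ^ 2 = 0"
      using \<alpha>(4) by (subst quotient_rule_numerator) (simp_all add: kxy_derivation ac_simps)
    then have "pd_y (\<phi> vary / vary) = 0" by simp
    then obtain b where "\<phi> vary / vary = of_kx b" by (rule pd_y_eq_0_imp_of_kx)
    then have "\<phi> vary = of_kx b * vary" by (simp add: field_simps)
    moreover from this v have "b \<noteq> 0" by auto
    ultimately show thesis using \<alpha> by (intro eta) simp_all
  next
    assume [simp]: "m = -1"
    have "const_kxy (-1) = (-1 :: 'k kxy)"
      using const_kxy_simps(3)[of "-1 :: 'k" 1]
      by (simp add: eq_neg_iff_add_eq_0 del: const_kxy_simps(3))
    then have "pd_y (\<phi> vary * vary) = 0"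
      using \<alpha>(4) by (simp add: kxy_derivation ac_simps)
    then obtain b where "\<phi> vary * vary = of_kx b" by (rule pd_y_eq_0_imp_of_kx)
    then have "\<phi> vary = of_kx b * inverse vary" by (simp add: field_simps)
    moreover from this v have "b \<noteq> 0" by auto
    ultimately show thesis using \<alpha> by (intro tau) simp_all
  qed
qed

section \<open>Semidirect products and the group of Poisson automorphisms\<close>

lemma group_semidirect:
  assumes N: "group N" and H: "group H"
    and act: "\<And>h. h \<in> carrier H \<Longrightarrow> act h \<in> hom N N"
    and act_one: "\<And>u. u \<in> carrier N \<Longrightarrow> act \<one>\<^bsub>H\<^esub> u = u"
    and act_mult: "\<And>h h' u. h \<in> carrier H \<Longrightarrow> h' \<in> carrier H \<Longrightarrow> u \<in> carrier N \<Longrightarrow>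
      act (h \<otimes>\<^bsub>H\<^esub> h') u = act h (act h' u)"
  shows "group (semidirect N H act)"
proof -
  interpret N: group N by fact
  interpret H: group H by fact
  have closed: "act h u \<in> carrier N" if "h \<in> carrier H" "u \<in> carrier N" for h u
    using act that by (auto simp: hom_def)
  have mult: "act h (u \<otimes>\<^bsub>N\<^esub> u') = act h u \<otimes>\<^bsub>N\<^esub> act h u'"
    if "h \<in> carrier H" "u \<in> carrier N" "u' \<in> carrier N" for h u u'
    using act that by (auto simp: hom_def)
  show ?thesis
  proof (rule groupI, goal_cases)
    case (1 p q)
    then show ?case by (auto simp: semidirect_def closed)
  next
    case 2
    show ?case by (simp add: semidirect_def)
  next
    case (3 p q r)
    then show ?case
      by (auto simp: semidirect_def closed mult act_mult N.m_assoc H.m_assoc)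
  next
    case (4 p)
    then show ?case by (auto simp: semidirect_def act_one)
  next
    case (5 p)
    then obtain u h where p: "p = (u, h)" "u \<in> carrier N" "h \<in> carrier H"
      by (auto simp: semidirect_def)
    \<comment> \<open>The left inverse of (u, h) is twisted: its first component is the inverse of u
      moved by the inverse of h.\<close>
    have "act (inv\<^bsub>H\<^esub> h) (inv\<^bsub>N\<^esub> u) \<otimes>\<^bsub>N\<^esub> act (inv\<^bsub>H\<^esub> h) u = act (inv\<^bsub>H\<^esub> h) \<one>\<^bsub>N\<^esub>"
      using p by (simp flip: mult)
    also have "\<dots> = \<one>\<^bsub>N\<^esub>"
      using hom_one[OF act N.is_group N.is_group] p(3) by simp
    finally show ?case
      using p by (intro bexI[of _ "(act (inv\<^bsub>H\<^esub> h) (inv\<^bsub>N\<^esub> u), inv\<^bsub>H\<^esub> h)"])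
        (auto simp: semidirect_def closed)
  qed
qed

section \<open>The groups in the extension\<close>

lemma carrier_Aut_Poi: "\<phi> \<in> carrier (Aut_Poi f) \<longleftrightarrow> poisson_automorphism f \<phi>"
  by (simp add: Aut_Poi_def)

lemma mult_Aut_Poi [simp]: "\<phi> \<otimes>\<^bsub>Aut_Poi f\<^esub> \<psi> = \<phi> \<circ> \<psi>"
  by (simp add: Aut_Poi_def)

lemma one_Aut_Poi [simp]: "\<one>\<^bsub>Aut_Poi f\<^esub> = id"
  by (simp add: Aut_Poi_def)

lemma group_Aut_Poi: "group (Aut_Poi f)"
proof (rule groupI)
  fix \<phi> assume "\<phi> \<in> carrier (Aut_Poi f)"
  then have "poisson_automorphism f \<phi>" "inv_into UNIV \<phi> \<circ> \<phi> = id"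
    by (simp_all add: carrier_Aut_Poi poisson_automorphism_def bij_is_inj)
  then show "\<exists>\<psi> \<in> carrier (Aut_Poi f). \<psi> \<otimes>\<^bsub>Aut_Poi f\<^esub> \<phi> = \<one>\<^bsub>Aut_Poi f\<^esub>"
    using poisson_automorphism_inv
    by (intro bexI[of _ "inv_into UNIV \<phi>"]) (auto simp: carrier_Aut_Poi)
qed (auto simp: carrier_Aut_Poi poisson_automorphism_comp poisson_automorphism_id comp_assoc)

lemma group_kx_units: "group kx_units"
proof (rule groupI)
  fix b :: "'a kx" assume "b \<in> carrier kx_units"
  then show "\<exists>c \<in> carrier kx_units. c \<otimes>\<^bsub>kx_units\<^esub> b = \<one>\<^bsub>kx_units\<^esub>"
    by (intro bexI[of _ "inverse b"]) (auto simp: kx_units_def)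
qed (auto simp: kx_units_def)

lemma group_roots_of_unity: "group (roots_of_unity n)"
proof (rule groupI)
  fix a :: 'a assume "a \<in> carrier (roots_of_unity n)"
  then show "\<exists>b \<in> carrier (roots_of_unity n). b \<otimes>\<^bsub>roots_of_unity n\<^esub> a = \<one>\<^bsub>roots_of_unity n\<^esub>"
    by (intro bexI[of _ "inverse a"]) (auto simp: roots_of_unity_def power_inverse)
qed (auto simp: roots_of_unity_def power_mult_distrib)

section \<open>The substitution x -> ax in k(x)\<close>

lemma scale_kx_mult:
  assumes "a \<noteq> 0"
  shows "scale_kx a (b * c) = scale_kx a b * scale_kx a c"
  using assms by (cases b; cases c) (simp add: scale_kx_Fract pcompose_mult pcompose_eq_0_iff)

lemma scale_kx_1_left [simp]: "scale_kx 1 b = b"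
  by (cases b) (simp add: scale_kx_Fract)

lemma scale_kx_scale_kx:
  assumes "a \<noteq> 0" "a' \<noteq> 0"
  shows "scale_kx a (scale_kx a' b) = scale_kx (a * a') b"
  using assms by (cases b)
    (simp add: scale_kx_Fract pcompose_eq_0_iff pcompose_assoc[symmetric] pcompose_pCons mult.commute)

lemma scale_kx_eq_0_iff [simp]:
  assumes "a \<noteq> 0"
  shows "scale_kx a b = 0 \<longleftrightarrow> b = 0"
  using assms by (cases b) (simp add: scale_kx_Fract pcompose_eq_0_iff Zero_fract_def eq_fract)

lemma scale_kx_inverse:
  assumes "a \<noteq> 0"
  shows "scale_kx a (inverse b) = inverse (scale_kx a b)"
proof (cases "b = 0")
  case False
  have "scale_kx a 1 = 1"
    using assms by (simp add: One_fract_def scale_kx_Fract pcompose_1)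
  then have "scale_kx a b * scale_kx a (inverse b) = 1"
    using False by (simp flip: scale_kx_mult[OF assms])
  then show ?thesis by (simp add: inverse_unique)
qed (use scale_kx_eq_0_iff[OF assms, of 0] in simp)

text \<open>The source of every twist below: a homomorphism that scales x acts on k(x) by
  substitution. Induction along Horner's scheme gives polynomials, division the rest.\<close>

lemma kxy_hom_of_kx:
  assumes \<phi>: "kxy_hom \<phi>" and x: "\<phi> varx = const_kxy a * varx" and a: "a \<noteq> 0"
  shows "\<phi> (of_kx b) = of_kx (scale_kx a b)"
proof -
  note hom = kxy_homD[OF \<phi>]
  have poly: "\<phi> (of_kx (to_fract p)) = of_kx (to_fract (pcompose p [:0, a:]))" for p
  proof (induction p)
    case (pCons c p)
    have 1: "of_kx (to_fract (pCons c q)) = const_kxy c + varx * of_kx (to_fract q)" for c and q :: "'a poly"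
    proof -
      have "pCons c q = [:c:] + [:0, 1:] * q" by simp
      then show ?thesis by (metis of_kx_const of_kx_simps(3,4) of_kx_varx to_fract_add to_fract_mult)
    qed
    have "pcompose (pCons c p) [:0, a:] = pCons c ([:a:] * pcompose p [:0, a:])"
      by (simp add: pcompose_pCons)
    then have "of_kx (to_fract (pcompose (pCons c p) [:0, a:])) =
        const_kxy c + varx * (const_kxy a * of_kx (to_fract (pcompose p [:0, a:])))"
      by (simp only: 1[of c] to_fract_mult of_kx_simps(4) of_kx_const)
    then show ?case by (simp add: 1 hom x pCons.IH)
  qed (simp add: hom)
  show ?thesis
    using a by (cases b) (simp add: Fract_conv_to_fract hom poly
        scale_kx_Fract[unfolded Fract_conv_to_fract])
qed

section \<open>Composition rules for eta and tau\<close>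

lemma const_kxy_minus_1: "const_kxy (-1) = (-1 :: 'k::field kxy)"
  using const_kxy_simps(3)[of "-1 :: 'k" 1] by (simp add: eq_neg_iff_add_eq_0 del: const_kxy_simps(3))

lemma const_kxy_eq_iff [simp]: "const_kxy c = const_kxy d \<longleftrightarrow> c = d"
  by (simp add: const_kxy_def)

text \<open>The outer map substitutes ax into b', which is the multiplication of
  \<open>kx_units_Cn\<close>, with the pair written as (b, a).\<close>

lemma eta_comp:
  fixes a a' :: "'k::field_char_0"
  assumes "a \<noteq> 0" "a ^ n = 1" "b \<noteq> 0" "a' \<noteq> 0" "a' ^ n = 1" "b' \<noteq> 0"
  shows "eta n a b \<circ> eta n a' b' = eta n (a * a') (b * scale_kx a b')"
proof -
  note e = eta[OF assms(1-3)] and e' = eta[OF assms(4-6)]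
  have e'': "poisson_automorphism (bracket_xy n) (eta n (a * a') (b * scale_kx a b')) \<and>
      eta n (a * a') (b * scale_kx a b') varx = const_kxy (a * a') * varx \<and>
      eta n (a * a') (b * scale_kx a b') vary = of_kx (b * scale_kx a b') * vary"
    using assms by (intro eta) (simp_all add: power_mult_distrib)
  have hom: "kxy_hom (eta n a b)" using e poisson_automorphism_kxy_hom by blast
  show ?thesis
  proof (rule kxy_hom_eqI)
    show "kxy_hom (eta n a b \<circ> eta n a' b')" "kxy_hom (eta n (a * a') (b * scale_kx a b'))"
      using e e' e'' poisson_automorphism_kxy_hom poisson_automorphism_comp by blast+
  qed (use e e' e'' assms(1) in \<open>simp_all add: kxy_homD[OF hom] kxy_hom_of_kx[OF hom]\<close>)
qed

lemma eta_inject: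
  fixes a a' :: "'k::field_char_0"
  assumes "a \<noteq> 0" "a ^ n = 1" "b \<noteq> 0" "a' \<noteq> 0" "a' ^ n = 1" "b' \<noteq> 0"
    and eq: "eta n a b = eta n a' b'"
  shows "a = a'" "b = b'"
proof -
  have "const_kxy a * varx = const_kxy a' * varx" "of_kx b * vary = of_kx b' * vary"
    using eta[OF assms(1-3)] eta[OF assms(4-6)] unfolding eq by metis+
  then show "a = a'" "b = b'" by simp_all
qed

lemma eta_eqI:
  fixes a :: "'k::field_char_0"
  assumes "poisson_automorphism (bracket_xy n) \<phi>" "a \<noteq> 0" "a ^ n = 1" "b \<noteq> 0"
    and "\<phi> varx = const_kxy a * varx" "\<phi> vary = of_kx b * vary"
  shows "\<phi> = eta n a b"
  by (rule kxy_hom_eqI)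
    (use assms(1,5,6) eta[OF assms(2-4)] poisson_automorphism_kxy_hom in auto)

text \<open>For odd n the constant -1 is an n-th root of -1, and this choice gives the involution
  that splits the sequence.\<close>

lemma tau_minus_1_comp_self:
  assumes "odd n"
  shows "tau n (-1) \<circ> tau n (-1) = (id :: 'k::field_char_0 kxy \<Rightarrow> 'k kxy)"
proof -
  have "(-1) ^ n = (-1 :: 'k)" using assms by simp
  note t = tau[OF _ this, simplified]
  have hom: "kxy_hom (tau n (-1 :: 'k))" using t poisson_automorphism_kxy_hom by blast
  have id: "kxy_hom (id :: 'k kxy \<Rightarrow> 'k kxy)" by (simp add: kxy_hom_def)
  show ?thesis
  proof (rule kxy_hom_eqI)
    show "kxy_hom (tau n (-1) \<circ> tau n (-1 :: 'k))"
      using t poisson_automorphism_kxy_hom poisson_automorphism_comp by blast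
  qed (use t id in \<open>simp_all add: kxy_homD[OF hom] const_kxy_minus_1\<close>)
qed

text \<open>Both sides send y to b(-x) / y. Conjugation by the involution therefore induces the
  automorphism in \<open>C2_act\<close>.\<close>

lemma tau_minus_1_comp_eta:
  fixes a :: "'k::field_char_0"
  assumes "odd n" "a \<noteq> 0" "a ^ n = 1" "b \<noteq> 0"
  shows "tau n (-1) \<circ> eta n a b = eta n a (inverse (scale_kx (-1) b)) \<circ> tau n (-1)"
proof -
  have "(-1) ^ n = (-1 :: 'k)" using assms(1) by simp
  note t = tau[OF _ this, simplified] and e = eta[OF assms(2-4)]
  have e': "poisson_automorphism (bracket_xy n) (eta n a (inverse (scale_kx (-1) b))) \<and>
      eta n a (inverse (scale_kx (-1) b)) varx = const_kxy a * varx \<and>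
      eta n a (inverse (scale_kx (-1) b)) vary = of_kx (inverse (scale_kx (-1) b)) * vary"
    using assms by (intro eta) simp_all
  have hom: "kxy_hom (tau n (-1 :: 'k))" "kxy_hom (eta n a b)" "kxy_hom (eta n a (inverse (scale_kx (-1) b)))"
    using t e e' poisson_automorphism_kxy_hom by blast+
  show ?thesis
  proof (rule kxy_hom_eqI)
    show "kxy_hom (tau n (-1) \<circ> eta n a b)" "kxy_hom (eta n a (inverse (scale_kx (-1) b)) \<circ> tau n (-1))"
      using t e e' poisson_automorphism_kxy_hom poisson_automorphism_comp by blast+
  qed (use t e e' in \<open>simp_all add: kxy_homD[OF hom(1)] kxy_homD[OF hom(2)] kxy_homD[OF hom(3)]
        kxy_hom_of_kx[OF hom(1)] const_kxy_minus_1\<close>)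
qed

section \<open>The semidirect products\<close>

lemma group_kx_units_Cn: "group (kx_units_Cn n)"
  unfolding kx_units_Cn_def
proof (rule group_semidirect[OF group_kx_units group_roots_of_unity])
  fix h :: 'a assume "h \<in> carrier (roots_of_unity n)"
  then show "scale_kx h \<in> hom kx_units kx_units"
    by (auto simp: hom_def roots_of_unity_def kx_units_def scale_kx_mult)
qed (auto simp: roots_of_unity_def scale_kx_scale_kx)

lemma carrier_kx_units_Cn:
  "p \<in> carrier (kx_units_Cn n) \<longleftrightarrow> (\<exists>b a. p = (b, a) \<and> b \<noteq> 0 \<and> a \<noteq> 0 \<and> a ^ n = 1)"
  by (auto simp: kx_units_Cn_def semidirect_def kx_units_def roots_of_unity_def)

lemma mult_kx_units_Cn [simp]:
  "(b, a) \<otimes>\<^bsub>kx_units_Cn n\<^esub> (b', a') = (b * scale_kx a b', a * a')"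
  by (simp add: kx_units_Cn_def semidirect_def kx_units_def roots_of_unity_def)

lemma carrier_C2: "s \<in> carrier C2 \<longleftrightarrow> s = 0 \<or> s = 1"
  by (auto simp: carrier_integer_mod_group)

lemma group_semidirect_C2_act: "group (semidirect (kx_units_Cn n) C2 C2_act)"
proof (rule group_semidirect[OF group_kx_units_Cn group_integer_mod_group])
  fix h assume "h \<in> carrier C2"
  then show "C2_act h \<in> hom (kx_units_Cn n) (kx_units_Cn n)"
    by (auto simp: hom_def carrier_C2 C2_act_def carrier_kx_units_Cn scale_kx_mult scale_kx_inverse
        scale_kx_scale_kx)
qed (auto simp: carrier_C2 C2_act_def carrier_kx_units_Cn scale_kx_inverse scale_kx_scale_kx)

section \<open>The extension\<close>

text \<open>For a Poisson automorphism, \<phi>(x)^n / x^n is 1 or -1; the values 0 and 1 are these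
  signs in additive notation.\<close>

definition sign_at_varx :: "nat \<Rightarrow> ('k::field kxy \<Rightarrow> 'k kxy) \<Rightarrow> int"
  where "sign_at_varx n \<phi> = (if \<phi> varx ^ n = varx ^ n then 0 else 1)"

lemma sign_at_varx_cases:
  fixes \<phi> :: "'k::{alg_closed_field, field_char_0} kxy \<Rightarrow> 'k kxy"
  assumes n: "n \<ge> 2" and \<phi>: "poisson_automorphism (bracket_xy n) \<phi>"
  obtains (eta) \<alpha> b where "sign_at_varx n \<phi> = 0" "\<phi> varx ^ n = varx ^ n"
      "\<alpha> \<noteq> 0" "\<alpha> ^ n = 1" "b \<noteq> 0" "\<phi> = eta n \<alpha> b"
  | (tau) \<alpha> b where "sign_at_varx n \<phi> = 1" "\<phi> varx ^ n = - (varx ^ n)"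
      "\<alpha> \<noteq> 0" "\<alpha> ^ n = -1" "b \<noteq> 0" "\<phi> = eta n 1 b \<circ> tau n \<alpha>" "\<phi> varx = const_kxy \<alpha> * varx"
  using n \<phi>
proof (cases rule: poisson_automorphism_cases)
  case (eta \<alpha> b)
  then have pow: "\<phi> varx ^ n = varx ^ n" by (simp add: power_mult_distrib flip: const_kxy_power)
  then have "sign_at_varx n \<phi> = 0" by (simp add: sign_at_varx_def)
  with pow eta eta_eqI[OF \<phi> eta(1-3)] show thesis by (intro that(1)) simp_all
next
  case (tau \<alpha> b)
  then have pow: "\<phi> varx ^ n = - (varx ^ n)"
    by (simp add: power_mult_distrib const_kxy_minus_1 flip: const_kxy_power)
  then have sign: "sign_at_varx n \<phi> = 1"
    using varxy_nonzero by (simp add: sign_at_varx_def)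
  \<comment> \<open>The inverse is needed because \<open>eta\<close> is applied after y has become
    1/y.\<close>
  have b: "inverse b \<noteq> 0" using tau by simp
  note e = Defs.eta[of "1 :: 'k" n, OF one_neq_zero power_one b] and t = Defs.tau[OF tau(1,2)]
  have hom: "kxy_hom (eta n 1 (inverse b))" using e poisson_automorphism_kxy_hom by blast
  have "\<phi> = eta n 1 (inverse b) \<circ> tau n \<alpha>"
  proof (rule kxy_hom_eqI)
    show "kxy_hom \<phi>" "kxy_hom (eta n 1 (inverse b) \<circ> tau n \<alpha>)"
      using \<phi> e t poisson_automorphism_kxy_hom poisson_automorphism_comp by blast+
  qed (use tau(4,5) e t in \<open>simp_all add: kxy_homD[OF hom]\<close>)
  with sign pow tau b show thesis by (intro that(2)[of \<alpha> "inverse b"]) simp_all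
qed

text \<open>As \<phi> is additive, it carries the sign of \<psi> through unchanged, so signs
  multiply. Characteristic zero keeps the two signs distinct.\<close>

lemma sign_at_varx_hom:
  fixes \<phi> \<psi> :: "'k::{alg_closed_field, field_char_0} kxy \<Rightarrow> 'k kxy"
  assumes n: "n \<ge> 2" and \<phi>: "poisson_automorphism (bracket_xy n) \<phi>"
    and \<psi>: "poisson_automorphism (bracket_xy n) \<psi>"
  shows "sign_at_varx n (\<phi> \<circ> \<psi>) = (sign_at_varx n \<phi> + sign_at_varx n \<psi>) mod 2"
proof -
  note hom = kxy_homD[OF poisson_automorphism_kxy_hom[OF \<phi>]]
  have cases: "sign_at_varx n \<chi> = 0 \<and> \<chi> varx ^ n = varx ^ n \<or> sign_at_varx n \<chi> = 1 \<and> \<chi> varx ^ n = - (varx ^ n)"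
    if "poisson_automorphism (bracket_xy n) \<chi>" for \<chi> :: "'k kxy \<Rightarrow> 'k kxy"
    using n that by (cases rule: sign_at_varx_cases) simp_all
  have "(\<phi> \<circ> \<psi>) varx ^ n = \<phi> (\<psi> varx ^ n)" by (simp add: hom)
  moreover have "\<phi> (varx ^ n) = \<phi> varx ^ n" "\<phi> (- (varx ^ n)) = - (\<phi> varx ^ n)"
    by (simp_all add: hom)
  moreover have "(varx :: 'k kxy) ^ n \<noteq> - (varx ^ n)" "- (varx ^ n) \<noteq> (varx :: 'k kxy) ^ n"
    using varxy_nonzero by simp_all
  ultimately show ?thesis
    using cases[OF \<phi>] cases[OF \<psi>] by (elim disjE conjE) (simp_all add: sign_at_varx_def[of n "\<phi> \<circ> \<psi>"])
qed

theorem proposition4p8: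
  fixes n :: nat
  assumes "n \<ge> 2"
  shows "let G = (Aut_K n :: ('k::{alg_closed_field, field_char_0} kxy \<Rightarrow> 'k kxy) monoid);
             N = (kx_units_Cn n :: ('k kx \<times> 'k) monoid)
         in carrier G = generate G
              ({eta n a b | a b. a \<noteq> 0 \<and> a ^ n = 1 \<and> b \<noteq> 0} \<union> {tau n c | c. c \<noteq> 0 \<and> c ^ n = -1}) \<and>
            (\<exists>\<pi>. short_exact N G C2 (\<lambda>(b, a). eta n a b) \<pi> \<and>
              (odd n \<longrightarrow> right_split G C2 \<pi> \<and> G \<cong> semidirect N C2 C2_act) \<and>
              (even n \<longrightarrow> \<not> right_split G C2 \<pi>))"
proof -
  define G where "G = (Aut_K n :: ('k kxy \<Rightarrow> 'k kxy) monoid)"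
  define N where "N = (kx_units_Cn n :: ('k kx \<times> 'k) monoid)"
  define \<iota> where "\<iota> = (\<lambda>(b, a). eta n a b :: 'k kxy \<Rightarrow> 'k kxy)"
  define \<pi> where "\<pi> = (sign_at_varx n :: ('k kxy \<Rightarrow> 'k kxy) \<Rightarrow> int)"
  interpret G: group G unfolding G_def by (rule group_Aut_Poi)
  have N: "group N" unfolding N_def by (rule group_kx_units_Cn)
  have carrier_G: "\<phi> \<in> carrier G \<longleftrightarrow> poisson_automorphism (bracket_xy n) \<phi>" for \<phi>
    by (simp add: G_def carrier_Aut_Poi)
  have mult_G: "\<phi> \<otimes>\<^bsub>G\<^esub> \<psi> = \<phi> \<circ> \<psi>" for \<phi> \<psi> by (simp add: G_def)
  have eta_G: "eta n a b \<in> carrier G" if "a \<noteq> 0" "a ^ n = 1" "b \<noteq> 0" for a :: 'k and b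
    using eta[OF that] by (simp add: carrier_G)
  have tau_G: "tau n c \<in> carrier G" if "c \<noteq> 0" "c ^ n = -1" for c :: 'k
    using tau[OF that] by (simp add: carrier_G)
  have minus_1: "(-1) ^ n = (-1 :: 'k)" if "odd n" using that by simp
  have tau_tau: "tau n (-1) \<circ> tau n (-1 :: 'k) = id" if "odd n"
    using that by (rule tau_minus_1_comp_self)

  \<comment> \<open>The sign homomorphism\<close>
  have \<pi>_0: "\<pi> \<phi> = 0 \<longleftrightarrow> \<phi> varx ^ n = varx ^ n" for \<phi>
    by (simp add: \<pi>_def sign_at_varx_def)
  have \<pi>_eta: "\<pi> (eta n a b) = 0" if "a \<noteq> 0" "a ^ n = 1" "b \<noteq> 0" for a :: 'k and b
    using eta[OF that] that by (simp add: \<pi>_0 power_mult_distrib flip: const_kxy_power)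
  have \<pi>_tau: "\<pi> (tau n c) = 1" if "c \<noteq> 0" "c ^ n = -1" for c :: 'k
  proof -
    have "tau n c varx ^ n = - (varx ^ n)"
      using tau[OF that] that by (simp add: power_mult_distrib const_kxy_minus_1 flip: const_kxy_power)
    then have "\<pi> (tau n c) \<noteq> 0" using varxy_nonzero by (simp add: \<pi>_0)
    then show ?thesis by (simp add: \<pi>_def sign_at_varx_def split: if_splits)
  qed
  have \<pi>_C2: "\<pi> \<phi> \<in> carrier C2" for \<phi>
    by (simp add: \<pi>_def sign_at_varx_def carrier_C2)
  have \<pi>_hom: "\<pi> \<in> hom G C2"
    by (rule homI) (use \<pi>_C2 sign_at_varx_hom[OF assms] in \<open>simp_all add: carrier_G mult_G \<pi>_def\<close>)

  \<comment> \<open>Exactness of the sequence\<close>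
  have \<iota>_mon: "\<iota> \<in> mon N G"
  proof -
    have "\<iota> \<in> hom N G"
      by (auto simp: hom_def N_def carrier_kx_units_Cn \<iota>_def eta_G mult_G eta_comp)
    moreover have "inj_on \<iota> (carrier N)"
      by (auto simp: inj_on_def N_def carrier_kx_units_Cn \<iota>_def dest: eta_inject)
    ultimately show ?thesis by (simp add: mon_def)
  qed
  have "\<phi> \<in> \<iota> ` carrier N" if "\<phi> \<in> carrier G" "\<pi> \<phi> = 0" for \<phi>
    using assms that(1)[unfolded carrier_G]
  proof (cases rule: sign_at_varx_cases)
    case (eta \<alpha> b)
    then show ?thesis by (auto simp: \<iota>_def N_def carrier_kx_units_Cn intro!: image_eqI[of _ _ "(b, \<alpha>)"])
  qed (use that in \<open>simp add: \<pi>_def\<close>)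
  moreover have "\<pi> (\<iota> p) = 0" "\<iota> p \<in> carrier G" if "p \<in> carrier N" for p
    using that by (auto simp: N_def carrier_kx_units_Cn \<iota>_def \<pi>_eta eta_G)
  ultimately have kernel: "\<iota> ` carrier N = kernel G C2 \<pi>"
    by (auto simp: kernel_def)
  \<comment> \<open>Algebraic closedness supplies some tau, whose sign is 1, so \<pi> is
    onto.\<close>
  obtain c :: 'k where c: "c ^ n = -1"
    using nth_root_exists[of n "-1 :: 'k"] assms by auto
  then have "c \<noteq> 0" using assms by (auto simp: power_0_left)
  have "\<pi> \<in> epi G C2"
    unfolding epi_iff_subset
  proof (intro conjI \<pi>_hom subsetI)
    fix s assume "s \<in> carrier C2"
    then consider "s = \<pi> \<one>\<^bsub>G\<^esub>" | "s = \<pi> (tau n c)"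
      using \<pi>_tau[OF \<open>c \<noteq> 0\<close> c] by (auto simp: carrier_C2 \<pi>_0 G_def)
    then show "s \<in> \<pi> ` carrier G"
      by cases (use tau_G[OF \<open>c \<noteq> 0\<close> c] in auto)
  qed
  with \<iota>_mon kernel have exact: "short_exact N G C2 \<iota> \<pi>"
    by (simp add: short_exact_def N G.is_group)

  \<comment> \<open>Generators\<close>
  let ?S = "{eta n a b | a b. a \<noteq> 0 \<and> a ^ n = 1 \<and> b \<noteq> 0} \<union> {tau n c | c :: 'k. c \<noteq> 0 \<and> c ^ n = -1}"
  have generated: "carrier G = generate G ?S"
  proof
    show "generate G ?S \<subseteq> carrier G"
      by (rule G.generate_incl) (auto simp: eta_G tau_G)
    show "carrier G \<subseteq> generate G ?S"
    proof
      fix \<phi> assume "\<phi> \<in> carrier G"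
      with assms show "\<phi> \<in> generate G ?S"
        unfolding carrier_G
      proof (cases rule: sign_at_varx_cases)
        case (eta \<alpha> b)
        then show ?thesis by (intro generate.incl) blast
      next
        case (tau \<alpha> b)
        then have "eta n 1 b \<in> ?S"
          by (intro UnI1 CollectI exI[of _ 1] exI[of _ b]) simp
        moreover have "tau n \<alpha> \<in> ?S" using tau by blast
        ultimately have "eta n 1 b \<otimes>\<^bsub>G\<^esub> tau n \<alpha> \<in> generate G ?S"
          by (intro generate.eng generate.incl)
        then show ?thesis using tau by (simp add: mult_G)
      qed
    qed
  qed

  \<comment> \<open>The section for odd n\<close>
  have split: "right_split G C2 \<pi>" if odd: "odd n"
    unfolding right_split_def
  proof (intro bexI ballI)
    let ?s = "\<lambda>k :: int. if k = 0 then id else tau n (-1 :: 'k)"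
    have t: "tau n (-1 :: 'k) \<in> carrier G" "\<pi> (tau n (-1)) = 1"
      using tau_G \<pi>_tau minus_1[OF odd] by simp_all
    have "id \<in> carrier G" "\<pi> id = 0" by (simp_all add: carrier_G poisson_automorphism_id \<pi>_0)
    then show "?s \<in> hom C2 G"
      using t tau_tau[OF odd] by (auto simp: hom_def carrier_C2 mult_G)
    show "\<pi> (?s k) = k" if "k \<in> carrier C2" for k
      using that t \<open>\<pi> id = 0\<close> by (auto simp: carrier_C2)
  qed

  \<comment> \<open>The isomorphism with the semidirect product for odd n\<close>
  have iso: "G \<cong> semidirect N C2 C2_act" if odd: "odd n"
  proof -
    let ?S = "semidirect N C2 C2_act"
    \<comment> \<open>The usual map of a split extension: an element of the kernel times the value
      of the section.\<close>
    define h where "h = (\<lambda>((b, a), k :: int). if k = 0 then eta n a b else eta n a b \<circ> tau n (-1 :: 'k))"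
    have t: "tau n (-1 :: 'k) \<in> carrier G" "\<pi> (tau n (-1)) = 1"
      using tau_G \<pi>_tau minus_1[OF odd] by simp_all
    have tt: "(\<phi> \<circ> tau n (-1 :: 'k)) \<circ> tau n (-1) = \<phi>" for \<phi>
      using tau_tau[OF odd] by (simp add: comp_assoc)
    have sign_t: "\<pi> (\<phi> \<circ> tau n (-1)) = (\<pi> \<phi> + 1) mod 2" if "\<phi> \<in> carrier G" for \<phi>
      using \<pi>_hom that t by (auto simp: hom_def mult_G)
    have carrier_S: "p \<in> carrier ?S \<longleftrightarrow> (\<exists>b a k. p = ((b, a), k) \<and> b \<noteq> 0 \<and> a \<noteq> 0 \<and> a ^ n = 1 \<and> (k = 0 \<or> k = 1))" for p
      by (auto simp: semidirect_def N_def carrier_kx_units_Cn carrier_C2 simp del: carrier_integer_mod_group)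
    have "h \<in> hom ?S G"
    proof (rule homI)
      fix p q assume "p \<in> carrier ?S" "q \<in> carrier ?S"
      then obtain b a k b' a' k' where p: "p = ((b, a), k)" "b \<noteq> 0" "a \<noteq> 0" "a ^ n = 1" "k = 0 \<or> k = 1"
        and q: "q = ((b', a'), k')" "b' \<noteq> 0" "a' \<noteq> 0" "a' ^ n = 1" "k' = 0 \<or> k' = 1"
        unfolding carrier_S by blast
      show "h p \<in> carrier G"
        using p eta_G t G.m_closed by (auto simp: h_def mult_G[symmetric])
      have e: "eta n a b \<circ> eta n a' b' = eta n (a * a') (b * scale_kx a b')"
        using p q by (intro eta_comp) auto
      have e': "eta n a b \<circ> eta n a' (inverse (scale_kx (-1) b')) =
          eta n (a * a') (b * scale_kx a (inverse (scale_kx (-1) b')))"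
        using p q by (intro eta_comp) auto
      have te: "tau n (-1) \<circ> eta n a' b' = eta n a' (inverse (scale_kx (-1) b')) \<circ> tau n (-1)"
        using q by (intro tau_minus_1_comp_eta odd)
      \<comment> \<open>Versions with a trailing \<phi> let the simplifier rewrite inside
        right-nested compositions.\<close>
      have te': "tau n (-1) \<circ> (eta n a' b' \<circ> \<phi>) = eta n a' (inverse (scale_kx (-1) b')) \<circ> (tau n (-1) \<circ> \<phi>)" for \<phi>
        using te by (metis comp_assoc)
      have ee': "eta n a b \<circ> (eta n a' (inverse (scale_kx (-1) b')) \<circ> \<phi>) =
          eta n (a * a') (b * scale_kx a (inverse (scale_kx (-1) b'))) \<circ> \<phi>" for \<phi>
        using e' by (metis comp_assoc)
      have ee: "eta n a b \<circ> (eta n a' b' \<circ> \<phi>) = eta n (a * a') (b * scale_kx a b') \<circ> \<phi>" for \<phi>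
        using e by (metis comp_assoc)
      show "h (p \<otimes>\<^bsub>?S\<^esub> q) = h p \<otimes>\<^bsub>G\<^esub> h q"
        using p(5) q(5)
        by (elim disjE; simp add: p(1) q(1) semidirect_def N_def h_def mult_G C2_act_def comp_assoc e e' ee te te' ee'
            tau_tau[OF odd])
    qed
    moreover have "bij_betw h (carrier ?S) (carrier G)"
    proof (rule bij_betw_imageI)
      \<comment> \<open>The sign recovers the C2 component, which reduces injectivity to that of
        eta.\<close>
      have k: "\<pi> (h ((b, a), k)) = k"
        if "b \<noteq> 0" "a \<noteq> 0" "a ^ n = 1" "k = 0 \<or> k = 1" for b a k
        using that eta_G \<pi>_eta sign_t by (auto simp: h_def)
      show "inj_on h (carrier ?S)"
      proof (rule inj_onI)
        fix p q assume "p \<in> carrier ?S" "q \<in> carrier ?S" and eq: "h p = h q"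
        then obtain b a k b' a' k' where p: "p = ((b, a), k)" "b \<noteq> 0" "a \<noteq> 0" "a ^ n = 1" "k = 0 \<or> k = 1"
          and q: "q = ((b', a'), k')" "b' \<noteq> 0" "a' \<noteq> 0" "a' ^ n = 1" "k' = 0 \<or> k' = 1"
          unfolding carrier_S by blast
        have "k = k'" using k[OF p(2-5)] k[OF q(2-5)] eq p(1) q(1) by simp
        have "eta n a b = eta n a' b'"
        proof (cases "k = 0")
          case True
          then show ?thesis using eq \<open>k = k'\<close> by (simp add: h_def p(1) q(1))
        next
          case False
          then have "eta n a b \<circ> tau n (-1) = eta n a' b' \<circ> tau n (-1)"
            using eq \<open>k = k'\<close> by (simp add: h_def p(1) q(1))
          then have "(eta n a b \<circ> tau n (-1)) \<circ> tau n (-1) = (eta n a' b' \<circ> tau n (-1)) \<circ> tau n (-1)"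
            by (simp only:)
          then show ?thesis by (simp only: tt)
        qed
        then show "p = q"
          using eta_inject[OF p(3,4,2) q(3,4,2)] \<open>k = k'\<close> p(1) q(1) by simp
      qed
      show "h ` carrier ?S = carrier G"
      proof
        show "h ` carrier ?S \<subseteq> carrier G"
          using \<open>h \<in> hom ?S G\<close> by (auto simp: hom_def)
        show "carrier G \<subseteq> h ` carrier ?S"
        proof
          fix \<phi> assume \<phi>: "\<phi> \<in> carrier G"
          define k where "k = \<pi> \<phi>"
          \<comment> \<open>Composing with the involution when the sign is 1 moves \<phi> into the
            kernel.\<close>
          define \<psi> where "\<psi> = (if k = 0 then \<phi> else \<phi> \<circ> tau n (-1))"
          have k: "k = 0 \<or> k = 1" by (simp add: k_def \<pi>_def sign_at_varx_def)
          have "\<psi> \<in> carrier G"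
            using \<phi> t G.m_closed by (auto simp: \<psi>_def mult_G[symmetric])
          moreover have "\<pi> \<psi> = 0"
            using k sign_t[OF \<phi>] by (auto simp: \<psi>_def k_def)
          ultimately have "\<psi> \<in> \<iota> ` carrier N"
            unfolding kernel by (simp add: kernel_def)
          then obtain b a where "b \<noteq> 0" "a \<noteq> 0" "a ^ n = 1" "\<psi> = eta n a b"
            by (auto simp: N_def carrier_kx_units_Cn \<iota>_def)
          moreover from this have "h ((b, a), k) = \<phi>"
            using k tt[of \<phi>] by (auto simp: h_def \<psi>_def)
          ultimately show "\<phi> \<in> h ` carrier ?S"
            using k by (intro image_eqI[of _ _ "((b, a), k)"]) (auto simp: carrier_S)
        qed
      qed
    qed
    ultimately have "h \<in> iso ?S G" by (rule isoI)
    moreover have "group ?S" unfolding N_def by (rule group_semidirect_C2_act)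
    ultimately show ?thesis using group.iso_sym is_isoI by blast
  qed

  \<comment> \<open>No section for even n\<close>
  have no_split: "\<not> right_split G C2 \<pi>" if even: "even n"
  proof
    assume "right_split G C2 \<pi>"
    then obtain s where s: "s \<in> hom C2 G" "\<And>k. k \<in> carrier C2 \<Longrightarrow> \<pi> (s k) = k"
      unfolding right_split_def by blast
    define \<phi> where "\<phi> = s 1"
    have 1: "1 \<in> carrier C2" by (simp add: carrier_C2)
    then have \<phi>: "\<phi> \<in> carrier G" "\<pi> \<phi> = 1" using s by (auto simp: \<phi>_def hom_def)
    have s_0: "s 0 = id"
      using hom_one[OF s(1) group_integer_mod_group G.is_group] by (simp add: G_def)
    have "\<phi> \<circ> \<phi> = s (1 \<otimes>\<^bsub>C2\<^esub> 1)"
      using hom_mult[OF s(1) 1 1] by (simp only: mult_G \<phi>_def)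
    \<comment> \<open>Here 1 + 1 = 0 in C2, so the value of a section at 1 would be an involution of
      sign 1.\<close>
    also have "\<dots> = id" by (simp add: s_0)
    finally have \<phi>\<phi>: "\<phi> (\<phi> g) = g" for g
      by (metis comp_apply id_apply)
    obtain \<alpha> where \<alpha>: "\<alpha> ^ n = -1" "\<phi> varx = const_kxy \<alpha> * varx"
      using assms \<phi>(1)[unfolded carrier_G]
    proof (cases rule: sign_at_varx_cases)
      case (eta \<alpha> b)
      then show ?thesis using \<phi>(2) by (simp add: \<pi>_def)
    qed
    have "kxy_hom \<phi>" using \<phi>(1) poisson_automorphism_kxy_hom by (simp add: carrier_G)
    then have "const_kxy (\<alpha> * \<alpha>) * varx = const_kxy 1 * varx"
      using \<phi>\<phi>[of varx] \<alpha>(2) by (simp add: kxy_homD mult.assoc)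
    then have "const_kxy (\<alpha> * \<alpha>) = const_kxy 1"
      using varxy_nonzero(1) mult_right_cancel by blast
    \<comment> \<open>For even n this gives \<alpha>^n = 1, against \<alpha>^n = -1.\<close>
    then have "\<alpha> ^ 2 = 1" by (simp add: power2_eq_square del: const_kxy_simps)
    moreover obtain m where "n = 2 * m" using even by blast
    ultimately have "\<alpha> ^ n = 1" by (simp add: power_mult)
    then show False using \<alpha>(1) by simp
  qed
  show ?thesis
    unfolding Let_def G_def[symmetric] N_def[symmetric] \<iota>_def[symmetric]
    by (intro conjI exI[of _ \<pi>] impI generated exact split iso no_split)
qed

end
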